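(* Let $\mathcal{D}=(G,\chi,a,\alpha)$ be a datum and let $n$ be the order of $\chi(a)$. Let $\mathcal{H}=(H_{\mathcal{D}},\cdot,\mathbin{:})$ be a Hopf $q$-brace structure on $H_{\mathcal{D}}$ such that $x\cdot x=x\mathbin{:}x=0$, let $\lambda,\xi\colon G\to\mathds{k}^{\times}$ be the characters such that $x\cdot g=\lambda(g)x$ and $x\mathbin{:}g=\xi(g)x$ for all $g\in G$, and let $s\colon H_{\mathcal{D}}\otimes H_{\mathcal{D}}\to H_{\mathcal{D}}\otimes H_{\mathcal{D}}$ be the weak braiding operator associated with $\mathcal{H}$. Then, for all $h,g\in G$ and $0\le j,j'<n$, $$s(hx^j\otimes gx^{j'})={}^h(gx^{j'})\otimes(hx^j)^{ga^{j'}}=\xi^{j'}(h^g)\,({}^hg)x^{j'}\otimes\lambda^{-j}(ga^{j'})\,h^gx^j.$$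
   Context: $\mathds{k}$ is an algebraically closed field of characteristic zero, $\mathbb{N}_0=\{0,1,2,\dots\}$. Sweedler notation is used. The operations $x^y$ and ${}^xy$ (defined below) have highest precedence, then multiplication, then $\cdot$ and $\mathbin{:}$, then $+$ and $-$. Rank one pointed Hopf algebras. A datum $\mathcal{D}=(G,\chi,a,\alpha)$ consists of a finite group $G$, a character $\chi\colon G\to\mathds{k}^{\times}$, a central element $a\in G$ and $\alpha\in\mathds{k}$ such that, denoting by $n$ the order of $\chi(a)$, one has $n>1$ and ($\alpha(a^n-1)=0$ in $\mathds{k}[G]$ or $\chi^n=1$). $H_{\mathcal{D}}$ is the Hopf algebra generated as an algebra by $G$ and $x$, subject to the group relations of $G$, $x^n=\alpha(a^n-1)$ and $xg=\chi(g)gx$ for $g\in G$, with $\Delta(x)=x\otimes a+1\otimes x$, $\Delta(g)=g\otimes g$ (so $\epsilon(g)=1$, $\epsilon(x)=0$). It has $\mathds{k}$-basis $\{gx^m: g\in G,\ 0\le m<n\}$. Hopf $q$-braces. Let $X$ be a coalgebra and $p,d\colon X\otimes X\to X$ linear maps with $\epsilon\circ p=\epsilon\circ d=\epsilon\otimes\epsilon$; write $x\cdot y=p(x\otimes y)$, $x\mathbin{:}y=d(x\otimes y)$. $(X,\cdot,\mathbin{:})$ is a $q$-magma coalgebra if the map $X\otimes X^{\mathrm{cop}}\to X^{\mathrm{cop}}\otimes X$, $x\otimes y\mapsto y_{(1)}\mathbin{:}x_{(2)}\otimes x_{(1)}\cdot y_{(2)}$, is a coalgebra morphism. It is left regular if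 $\overline{G}(x\otimes y)=x\cdot y_{(1)}\otimes y_{(2)}$ is bijective on $X\otimes X$, right regular if $x\otimes y\mapsto x\mathbin{:}y_{(2)}\otimes y_{(1)}$ is bijective, and regular if it is both. A $q$-cycle coalgebra is a left regular $q$-magma coalgebra such that for all $u,v,w$: $(u\cdot v_{(1)})\cdot(w\mathbin{:}v_{(2)})=(u\cdot w_{(2)})\cdot(v\cdot w_{(1)})$, $(u\cdot v_{(1)})\mathbin{:}(w\cdot v_{(2)})=(u\mathbin{:}w_{(2)})\cdot(v\mathbin{:}w_{(1)})$, $(u\mathbin{:}v_{(1)})\mathbin{:}(w\mathbin{:}v_{(2)})=(u\mathbin{:}w_{(2)})\mathbin{:}(v\cdot w_{(1)})$. A Hopf $q$-brace is a Hopf algebra $H$ with a regular $q$-cycle coalgebra structure $(H,\cdot,\mathbin{:})$ such that $(H,\cdot)$ and $(H,\mathbin{:})$ are right $H^{\mathrm{op}}$-modules (i.e. $h\cdot 1=h$, $h\cdot kl=(h\cdot l)\cdot k$, and likewise for $\mathbin{:}$) and, for all $h,k,l\in H$, $hk\cdot l=(h\cdot(l_{(1)}\mathbin{:}k_{(2)}))(k_{(1)}\cdot l_{(2)})$ and $hk\mathbin{:}l=(h\mathbin{:}(l_{(1)}\cdot k_{(2)}))(k_{(1)}\mathbin{:}l_{(2)})$. Associated operations. $x^y:=(\mathrm{id}\otimes\epsilon)\overline{G}^{-1}(x\otimes y)$, so that $x\otimes y\mapsto x^y$ is the unique linear map satisfying $(x\cdot y_{(1)})^{y_{(2)}}=x^{y_{(1)}}\cdot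 y_{(2)}=\epsilon(y)x$; and ${}^xy:=y_{(2)}\mathbin{:}x^{y_{(1)}}$. The weak braiding operator associated with $\mathcal{H}$ is $(H_{\mathcal{D}},s)$ with $s(h\otimes l)={}^{h_{(1)}}l_{(1)}\otimes {h_{(2)}}^{l_{(2)}}$. For $h,g\in G$ one has $h^g,{}^hg\in G$. Known facts: for a Hopf $q$-brace on $H_{\mathcal{D}}$ with $x\cdot x=x\mathbin{:}x=0$, one has $a\cdot g=a\mathbin{:}g=a$, $g\cdot a=g\mathbin{:}a=g$ for $g\in G$, and for all $h,g\in G$, $j,j'\in\mathbb{N}_0$: $hx^j\cdot gx^{j'}=\lambda(g)^j(h\cdot g)x^j$ and $hx^j\mathbin{:}gx^{j'}=\xi(g)^j(h\mathbin{:}g)x^j$ if $j'=0$, and both are $0$ if $j'>0$. *)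

theory Defs
  imports
    "HOL-Library.Poly_Mapping"
    "HOL-Computational_Algebra.Polynomial"
    "HOL-Algebra.Ideal"
begin

section \<open>Vector spaces and tensor products\<close>

text \<open>
  Over a field every vector space has a basis, so a vector space is taken to be the space
  \<open>'b \<Rightarrow>\<^sub>0 'k\<close> of finitely supported functions on an arbitrary type of basis indices \<open>'b\<close>.
  Then the tensor product of \<open>'b \<Rightarrow>\<^sub>0 'k\<close> and \<open>'c \<Rightarrow>\<^sub>0 'k\<close> is again such a space, namely
  \<open>'b \<times> 'c \<Rightarrow>\<^sub>0 'k\<close>, with the pure tensors given below. Nothing in the sequel refers to
  the basis except through these definitions.
\<close>

definition smul :: "'k::field \<Rightarrow> ('b \<Rightarrow>\<^sub>0 'k) \<Rightarrow> ('b \<Rightarrow>\<^sub>0 'k)" (infixr \<open>*\<^sub>k\<close> 75)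
  where "c *\<^sub>k v = Poly_Mapping.map ((*) c) v"

definition bvec :: "'b \<Rightarrow> ('b \<Rightarrow>\<^sub>0 'k::field)"
  where "bvec i = Poly_Mapping.single i 1"

definition tensor :: "('b \<Rightarrow>\<^sub>0 'k::field) \<Rightarrow> ('c \<Rightarrow>\<^sub>0 'k) \<Rightarrow> ('b \<times> 'c \<Rightarrow>\<^sub>0 'k)"
    (infixr \<open>\<otimes>\<^sub>k\<close> 74)
  where "x \<otimes>\<^sub>k y = (\<Sum>i\<in>Poly_Mapping.keys x. \<Sum>j\<in>Poly_Mapping.keys y.
           Poly_Mapping.single (i, j) (Poly_Mapping.lookup x i * Poly_Mapping.lookup y j))"

text \<open>
  \<open>sweedler t B\<close> is the value at \<open>t\<close> of the linear map on the tensor product induced by the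
  bilinear map \<open>B\<close>. In particular \<open>sweedler (\<Delta> h) (\<lambda>h1 h2. B h1 h2)\<close> is what is written
  $B(h_{(1)}, h_{(2)})$ in Sweedler notation.
\<close>

definition sweedler ::
    "('b \<times> 'c \<Rightarrow>\<^sub>0 'k::field) \<Rightarrow> (('b \<Rightarrow>\<^sub>0 'k) \<Rightarrow> ('c \<Rightarrow>\<^sub>0 'k) \<Rightarrow> ('d \<Rightarrow>\<^sub>0 'k)) \<Rightarrow> ('d \<Rightarrow>\<^sub>0 'k)"
  where "sweedler t B =
    (\<Sum>(i, j)\<in>Poly_Mapping.keys t. Poly_Mapping.lookup t (i, j) *\<^sub>k B (bvec i) (bvec j))"

abbreviation klinear :: "(('b \<Rightarrow>\<^sub>0 'k::field) \<Rightarrow> ('c \<Rightarrow>\<^sub>0 'k)) \<Rightarrow> bool"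
  where "klinear \<equiv> Vector_Spaces.linear smul smul"

abbreviation kfunctional :: "(('b \<Rightarrow>\<^sub>0 'k::field) \<Rightarrow> 'k) \<Rightarrow> bool"
  where "kfunctional \<equiv> Vector_Spaces.linear smul (*)"

lemma lookup_smul: "Poly_Mapping.lookup (c *\<^sub>k v) i = c * Poly_Mapping.lookup v i"
  by (simp add: smul_def Poly_Mapping.map.rep_eq when_def)

lemma vector_space_smul: "vector_space (smul :: 'k::field \<Rightarrow> ('b \<Rightarrow>\<^sub>0 'k) \<Rightarrow> ('b \<Rightarrow>\<^sub>0 'k))"
  by unfold_locales
    (auto intro!: poly_mapping_eqI simp: lookup_smul lookup_add algebra_simps)

lemma tensor_lookup:
  "Poly_Mapping.lookup (x \<otimes>\<^sub>k y) (i, j) = Poly_Mapping.lookup x i * Poly_Mapping.lookup y j"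
proof -
  have "Poly_Mapping.lookup (x \<otimes>\<^sub>k y) (i, j) =
    (\<Sum>i'\<in>Poly_Mapping.keys x. \<Sum>j'\<in>Poly_Mapping.keys y.
      if j' = j then (if i' = i then Poly_Mapping.lookup x i * Poly_Mapping.lookup y j else 0) else 0)"
    unfolding tensor_def lookup_sum
    by (intro sum.cong refl) (auto simp: lookup_single when_def)
  also have "\<dots> = (\<Sum>i'\<in>Poly_Mapping.keys x.
      if i' = i then Poly_Mapping.lookup x i * Poly_Mapping.lookup y j else 0)"
    by (intro sum.cong refl) (simp add: sum.delta in_keys_iff)
  also have "\<dots> = Poly_Mapping.lookup x i * Poly_Mapping.lookup y j"
    by (simp add: sum.delta in_keys_iff)
  finally show ?thesis .
qed

lemma bvec_expansion: "(\<Sum>i\<in>Poly_Mapping.keys v. Poly_Mapping.lookup v i *\<^sub>k bvec i) = v"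
  by (rule poly_mapping_eqI)
    (simp add: lookup_sum lookup_smul bvec_def lookup_single when_def sum.delta in_keys_iff
      if_distrib[of "\<lambda>t. _ * t"] cong: if_cong)

lemma sweedler_tensor:
  fixes B :: "('b \<Rightarrow>\<^sub>0 'k::field) \<Rightarrow> ('c \<Rightarrow>\<^sub>0 'k) \<Rightarrow> ('d \<Rightarrow>\<^sub>0 'k)"
  assumes left: "\<And>y. klinear (\<lambda>x. B x y)" and right: "\<And>x. klinear (\<lambda>y. B x y)"
  shows "sweedler (x \<otimes>\<^sub>k y) B = B x y"
proof -
  interpret V: vector_space "smul :: 'k \<Rightarrow> ('d \<Rightarrow>\<^sub>0 'k) \<Rightarrow> ('d \<Rightarrow>\<^sub>0 'k)" by (rule vector_space_smul)
  let ?K = "Poly_Mapping.keys x \<times> Poly_Mapping.keys y"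
  have "Poly_Mapping.keys (x \<otimes>\<^sub>k y) = ?K"
    by (auto simp: in_keys_iff tensor_lookup)
  then have "sweedler (x \<otimes>\<^sub>k y) B =
      (\<Sum>(i, j)\<in>?K. (Poly_Mapping.lookup x i * Poly_Mapping.lookup y j) *\<^sub>k B (bvec i) (bvec j))"
    by (simp add: sweedler_def tensor_lookup)
  also have "\<dots> = (\<Sum>i\<in>Poly_Mapping.keys x. Poly_Mapping.lookup x i *\<^sub>k
      (\<Sum>j\<in>Poly_Mapping.keys y. Poly_Mapping.lookup y j *\<^sub>k B (bvec i) (bvec j)))"
    by (simp add: sum.cartesian_product[symmetric] V.scale_sum_right)
  also have "\<dots> = (\<Sum>i\<in>Poly_Mapping.keys x. Poly_Mapping.lookup x i *\<^sub>k B (bvec i) y)"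
  proof (intro sum.cong refl arg_cong[where f = "smul _"])
    fix i
    interpret R: Vector_Spaces.linear smul smul "\<lambda>y. B (bvec i) y" by (rule right)
    have "B (bvec i) (\<Sum>j\<in>Poly_Mapping.keys y. Poly_Mapping.lookup y j *\<^sub>k bvec j) =
       (\<Sum>j\<in>Poly_Mapping.keys y. Poly_Mapping.lookup y j *\<^sub>k B (bvec i) (bvec j))"
      by (simp add: R.sum R.scale)
    then show "(\<Sum>j\<in>Poly_Mapping.keys y. Poly_Mapping.lookup y j *\<^sub>k B (bvec i) (bvec j)) =
        B (bvec i) y" by (simp add: bvec_expansion)
  qed
  also have "\<dots> = B x y"
  proof -
    interpret L: Vector_Spaces.linear smul smul "\<lambda>x. B x y" by (rule left)
    have "B (\<Sum>i\<in>Poly_Mapping.keys x. Poly_Mapping.lookup x i *\<^sub>k bvec i) y =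
       (\<Sum>i\<in>Poly_Mapping.keys x. Poly_Mapping.lookup x i *\<^sub>k B (bvec i) y)"
      by (simp add: L.sum L.scale)
    then show ?thesis by (simp add: bvec_expansion)
  qed
  finally show ?thesis .
qed


section \<open>Algebras, coalgebras and Hopf algebras\<close>

locale k_algebra =
  fixes mul :: "('b \<Rightarrow>\<^sub>0 'k::field) \<Rightarrow> ('b \<Rightarrow>\<^sub>0 'k) \<Rightarrow> ('b \<Rightarrow>\<^sub>0 'k)"
    and oneH :: "'b \<Rightarrow>\<^sub>0 'k"
  assumes mul_linear_left: "klinear (\<lambda>h. mul h k)"
    and mul_linear_right: "klinear (\<lambda>k. mul h k)"
    and mul_assoc: "mul (mul h k) l = mul h (mul k l)"
    and one_mul: "mul oneH h = h"
    and mul_one: "mul h oneH = h"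

definition alg_pow ::
    "('h \<Rightarrow> 'h \<Rightarrow> 'h) \<Rightarrow> 'h \<Rightarrow> 'h \<Rightarrow> nat \<Rightarrow> 'h"
  where "alg_pow mul oneH h m = (mul h ^^ m) oneH"

locale k_coalgebra =
  fixes \<Delta> :: "('b \<Rightarrow>\<^sub>0 'k::field) \<Rightarrow> ('b \<times> 'b \<Rightarrow>\<^sub>0 'k)"
    and \<epsilon> :: "('b \<Rightarrow>\<^sub>0 'k) \<Rightarrow> 'k"
  assumes comult_linear: "klinear \<Delta>"
    and counit_linear: "kfunctional \<epsilon>"
    and coassoc: "sweedler (\<Delta> h) (\<lambda>h1 h2. \<Delta> h1 \<otimes>\<^sub>k h2) =
      sweedler (\<Delta> h) (\<lambda>h1 h2. sweedler (\<Delta> h2) (\<lambda>h21 h22. (h1 \<otimes>\<^sub>k h21) \<otimes>\<^sub>k h22))"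
    and counit_left: "sweedler (\<Delta> h) (\<lambda>h1 h2. \<epsilon> h1 *\<^sub>k h2) = h"
    and counit_right: "sweedler (\<Delta> h) (\<lambda>h1 h2. \<epsilon> h2 *\<^sub>k h1) = h"

definition cop_comult ::
    "(('b \<Rightarrow>\<^sub>0 'k::field) \<Rightarrow> ('b \<times> 'b \<Rightarrow>\<^sub>0 'k)) \<Rightarrow> ('b \<Rightarrow>\<^sub>0 'k) \<Rightarrow> ('b \<times> 'b \<Rightarrow>\<^sub>0 'k)"
  where "cop_comult \<Delta> h = sweedler (\<Delta> h) (\<lambda>h1 h2. h2 \<otimes>\<^sub>k h1)"

definition tensor_comult ::
    "(('b \<Rightarrow>\<^sub>0 'k::field) \<Rightarrow> ('b \<times> 'b \<Rightarrow>\<^sub>0 'k)) \<Rightarrow> (('c \<Rightarrow>\<^sub>0 'k) \<Rightarrow> ('c \<times> 'c \<Rightarrow>\<^sub>0 'k)) \<Rightarrow>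
      ('b \<times> 'c \<Rightarrow>\<^sub>0 'k) \<Rightarrow> (('b \<times> 'c) \<times> ('b \<times> 'c) \<Rightarrow>\<^sub>0 'k)"
  where "tensor_comult \<Delta>\<^sub>X \<Delta>\<^sub>Y t = sweedler t (\<lambda>x y.
    sweedler (\<Delta>\<^sub>X x) (\<lambda>x1 x2. sweedler (\<Delta>\<^sub>Y y) (\<lambda>y1 y2. (x1 \<otimes>\<^sub>k y1) \<otimes>\<^sub>k (x2 \<otimes>\<^sub>k y2))))"

definition tensor_counit ::
    "(('b \<Rightarrow>\<^sub>0 'k::field) \<Rightarrow> 'k) \<Rightarrow> (('c \<Rightarrow>\<^sub>0 'k) \<Rightarrow> 'k) \<Rightarrow> ('b \<times> 'c \<Rightarrow>\<^sub>0 'k) \<Rightarrow> 'k"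
  where "tensor_counit \<epsilon>\<^sub>X \<epsilon>\<^sub>Y t =
    (\<Sum>(i, j)\<in>Poly_Mapping.keys t. Poly_Mapping.lookup t (i, j) * (\<epsilon>\<^sub>X (bvec i) * \<epsilon>\<^sub>Y (bvec j)))"

definition coalgebra_morphism ::
    "(('b \<Rightarrow>\<^sub>0 'k::field) \<Rightarrow> ('b \<times> 'b \<Rightarrow>\<^sub>0 'k)) \<Rightarrow> (('b \<Rightarrow>\<^sub>0 'k) \<Rightarrow> 'k) \<Rightarrow>
      (('c \<Rightarrow>\<^sub>0 'k) \<Rightarrow> ('c \<times> 'c \<Rightarrow>\<^sub>0 'k)) \<Rightarrow> (('c \<Rightarrow>\<^sub>0 'k) \<Rightarrow> 'k) \<Rightarrow>
      (('b \<Rightarrow>\<^sub>0 'k) \<Rightarrow> ('c \<Rightarrow>\<^sub>0 'k)) \<Rightarrow> bool"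
  where "coalgebra_morphism \<Delta>\<^sub>X \<epsilon>\<^sub>X \<Delta>\<^sub>Y \<epsilon>\<^sub>Y f \<longleftrightarrow> klinear f \<and>
    (\<forall>x. \<Delta>\<^sub>Y (f x) = sweedler (\<Delta>\<^sub>X x) (\<lambda>x1 x2. f x1 \<otimes>\<^sub>k f x2)) \<and>
    (\<forall>x. \<epsilon>\<^sub>Y (f x) = \<epsilon>\<^sub>X x)"

locale hopf_algebra = k_algebra mul oneH + k_coalgebra \<Delta> \<epsilon>
  for mul :: "('b \<Rightarrow>\<^sub>0 'k::field) \<Rightarrow> ('b \<Rightarrow>\<^sub>0 'k) \<Rightarrow> ('b \<Rightarrow>\<^sub>0 'k)"
    and oneH :: "'b \<Rightarrow>\<^sub>0 'k"
    and \<Delta> :: "('b \<Rightarrow>\<^sub>0 'k) \<Rightarrow> ('b \<times> 'b \<Rightarrow>\<^sub>0 'k)"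
    and \<epsilon> :: "('b \<Rightarrow>\<^sub>0 'k) \<Rightarrow> 'k" +
  assumes comult_mul: "\<Delta> (mul h k) =
      sweedler (\<Delta> h) (\<lambda>h1 h2. sweedler (\<Delta> k) (\<lambda>k1 k2. mul h1 k1 \<otimes>\<^sub>k mul h2 k2))"
    and comult_one: "\<Delta> oneH = oneH \<otimes>\<^sub>k oneH"
    and counit_mul: "\<epsilon> (mul h k) = \<epsilon> h * \<epsilon> k"
    and counit_one: "\<epsilon> oneH = 1"
    and antipode: "\<exists>S. klinear S \<and>
      (\<forall>h. sweedler (\<Delta> h) (\<lambda>h1 h2. mul (S h1) h2) = \<epsilon> h *\<^sub>k oneH) \<and>
      (\<forall>h. sweedler (\<Delta> h) (\<lambda>h1 h2. mul h1 (S h2)) = \<epsilon> h *\<^sub>k oneH)"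


section \<open>Hopf q-braces\<close>

text \<open>
  The maps \<open>p\<close> and \<open>d\<close> are defined on the tensor product; \<open>p (x \<otimes>\<^sub>k y)\<close> and \<open>d (x \<otimes>\<^sub>k y)\<close> are
  the operations $x\cdot y$ and $x\mathbin{:}y$.
\<close>

definition q_magma_map ::
    "(('b \<Rightarrow>\<^sub>0 'k::field) \<Rightarrow> ('b \<times> 'b \<Rightarrow>\<^sub>0 'k)) \<Rightarrow>
      (('b \<times> 'b \<Rightarrow>\<^sub>0 'k) \<Rightarrow> ('b \<Rightarrow>\<^sub>0 'k)) \<Rightarrow> (('b \<times> 'b \<Rightarrow>\<^sub>0 'k) \<Rightarrow> ('b \<Rightarrow>\<^sub>0 'k)) \<Rightarrow>
      ('b \<times> 'b \<Rightarrow>\<^sub>0 'k) \<Rightarrow> ('b \<times> 'b \<Rightarrow>\<^sub>0 'k)"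
  where "q_magma_map \<Delta> p d t = sweedler t (\<lambda>x y.
    sweedler (\<Delta> x) (\<lambda>x1 x2. sweedler (\<Delta> y) (\<lambda>y1 y2. d (y1 \<otimes>\<^sub>k x2) \<otimes>\<^sub>k p (x1 \<otimes>\<^sub>k y2))))"

definition left_reg_map ::
    "(('b \<Rightarrow>\<^sub>0 'k::field) \<Rightarrow> ('b \<times> 'b \<Rightarrow>\<^sub>0 'k)) \<Rightarrow> (('b \<times> 'b \<Rightarrow>\<^sub>0 'k) \<Rightarrow> ('b \<Rightarrow>\<^sub>0 'k)) \<Rightarrow>
      ('b \<times> 'b \<Rightarrow>\<^sub>0 'k) \<Rightarrow> ('b \<times> 'b \<Rightarrow>\<^sub>0 'k)"
  where "left_reg_map \<Delta> p t = sweedler t (\<lambda>x y.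
    sweedler (\<Delta> y) (\<lambda>y1 y2. p (x \<otimes>\<^sub>k y1) \<otimes>\<^sub>k y2))"

definition right_reg_map ::
    "(('b \<Rightarrow>\<^sub>0 'k::field) \<Rightarrow> ('b \<times> 'b \<Rightarrow>\<^sub>0 'k)) \<Rightarrow> (('b \<times> 'b \<Rightarrow>\<^sub>0 'k) \<Rightarrow> ('b \<Rightarrow>\<^sub>0 'k)) \<Rightarrow>
      ('b \<times> 'b \<Rightarrow>\<^sub>0 'k) \<Rightarrow> ('b \<times> 'b \<Rightarrow>\<^sub>0 'k)"
  where "right_reg_map \<Delta> d t = sweedler t (\<lambda>x y.
    sweedler (\<Delta> y) (\<lambda>y1 y2. d (x \<otimes>\<^sub>k y2) \<otimes>\<^sub>k y1))"

locale q_magma_coalgebra = k_coalgebra \<Delta> \<epsilon>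
  for \<Delta> :: "('b \<Rightarrow>\<^sub>0 'k::field) \<Rightarrow> ('b \<times> 'b \<Rightarrow>\<^sub>0 'k)"
    and \<epsilon> :: "('b \<Rightarrow>\<^sub>0 'k) \<Rightarrow> 'k" +
  fixes p d :: "('b \<times> 'b \<Rightarrow>\<^sub>0 'k) \<Rightarrow> ('b \<Rightarrow>\<^sub>0 'k)"
  assumes p_linear: "klinear p"
    and d_linear: "klinear d"
    and counit_p: "\<epsilon> (p t) = tensor_counit \<epsilon> \<epsilon> t"
    and counit_d: "\<epsilon> (d t) = tensor_counit \<epsilon> \<epsilon> t"
    and q_magma_morphism: "coalgebra_morphism
      (tensor_comult \<Delta> (cop_comult \<Delta>)) (tensor_counit \<epsilon> \<epsilon>)
      (tensor_comult (cop_comult \<Delta>) \<Delta>) (tensor_counit \<epsilon> \<epsilon>)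
      (q_magma_map \<Delta> p d)"

locale left_regular_q_magma_coalgebra = q_magma_coalgebra \<Delta> \<epsilon> p d
  for \<Delta> :: "('b \<Rightarrow>\<^sub>0 'k::field) \<Rightarrow> ('b \<times> 'b \<Rightarrow>\<^sub>0 'k)"
    and \<epsilon> :: "('b \<Rightarrow>\<^sub>0 'k) \<Rightarrow> 'k"
    and p d :: "('b \<times> 'b \<Rightarrow>\<^sub>0 'k) \<Rightarrow> ('b \<Rightarrow>\<^sub>0 'k)" +
  assumes left_regular: "bij (left_reg_map \<Delta> p)"

locale q_cycle_coalgebra = left_regular_q_magma_coalgebra \<Delta> \<epsilon> p d
  for \<Delta> :: "('b \<Rightarrow>\<^sub>0 'k::field) \<Rightarrow> ('b \<times> 'b \<Rightarrow>\<^sub>0 'k)"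
    and \<epsilon> :: "('b \<Rightarrow>\<^sub>0 'k) \<Rightarrow> 'k"
    and p d :: "('b \<times> 'b \<Rightarrow>\<^sub>0 'k) \<Rightarrow> ('b \<Rightarrow>\<^sub>0 'k)" +
  assumes q_cycle_1:
      "sweedler (\<Delta> v) (\<lambda>v1 v2. p (p (u \<otimes>\<^sub>k v1) \<otimes>\<^sub>k d (w \<otimes>\<^sub>k v2))) =
       sweedler (\<Delta> w) (\<lambda>w1 w2. p (p (u \<otimes>\<^sub>k w2) \<otimes>\<^sub>k p (v \<otimes>\<^sub>k w1)))"
    and q_cycle_2:
      "sweedler (\<Delta> v) (\<lambda>v1 v2. d (p (u \<otimes>\<^sub>k v1) \<otimes>\<^sub>k p (w \<otimes>\<^sub>k v2))) =
       sweedler (\<Delta> w) (\<lambda>w1 w2. p (d (u \<otimes>\<^sub>k w2) \<otimes>\<^sub>k d (v \<otimes>\<^sub>k w1)))"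
    and q_cycle_3:
      "sweedler (\<Delta> v) (\<lambda>v1 v2. d (d (u \<otimes>\<^sub>k v1) \<otimes>\<^sub>k d (w \<otimes>\<^sub>k v2))) =
       sweedler (\<Delta> w) (\<lambda>w1 w2. d (d (u \<otimes>\<^sub>k w2) \<otimes>\<^sub>k p (v \<otimes>\<^sub>k w1)))"

locale hopf_q_brace = hopf_algebra mul oneH \<Delta> \<epsilon> + q_cycle_coalgebra \<Delta> \<epsilon> p d
  for mul :: "('b \<Rightarrow>\<^sub>0 'k::field) \<Rightarrow> ('b \<Rightarrow>\<^sub>0 'k) \<Rightarrow> ('b \<Rightarrow>\<^sub>0 'k)"
    and oneH :: "'b \<Rightarrow>\<^sub>0 'k"
    and \<Delta> :: "('b \<Rightarrow>\<^sub>0 'k) \<Rightarrow> ('b \<times> 'b \<Rightarrow>\<^sub>0 'k)"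
    and \<epsilon> :: "('b \<Rightarrow>\<^sub>0 'k) \<Rightarrow> 'k"
    and p d :: "('b \<times> 'b \<Rightarrow>\<^sub>0 'k) \<Rightarrow> ('b \<Rightarrow>\<^sub>0 'k)" +
  assumes right_regular: "bij (right_reg_map \<Delta> d)"
    and p_one: "p (h \<otimes>\<^sub>k oneH) = h"
    and p_mul: "p (h \<otimes>\<^sub>k mul k l) = p (p (h \<otimes>\<^sub>k l) \<otimes>\<^sub>k k)"
    and d_one: "d (h \<otimes>\<^sub>k oneH) = h"
    and d_mul: "d (h \<otimes>\<^sub>k mul k l) = d (d (h \<otimes>\<^sub>k l) \<otimes>\<^sub>k k)"
    and mul_p: "p (mul h k \<otimes>\<^sub>k l) = sweedler (\<Delta> k) (\<lambda>k1 k2. sweedler (\<Delta> l) (\<lambda>l1 l2.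
          mul (p (h \<otimes>\<^sub>k d (l1 \<otimes>\<^sub>k k2))) (p (k1 \<otimes>\<^sub>k l2))))"
    and mul_d: "d (mul h k \<otimes>\<^sub>k l) = sweedler (\<Delta> k) (\<lambda>k1 k2. sweedler (\<Delta> l) (\<lambda>l1 l2.
          mul (d (h \<otimes>\<^sub>k p (l1 \<otimes>\<^sub>k k2))) (d (k1 \<otimes>\<^sub>k l2))))"

text \<open>
  \<open>right_act\<close> is $x^y = (\mathrm{id}\otimes\epsilon)\,\overline{G}^{-1}(x\otimes y)$ and
  \<open>left_act\<close> is ${}^x y = y_{(2)} \mathbin{:} x^{y_{(1)}}$.
\<close>

definition right_act ::
    "(('b \<Rightarrow>\<^sub>0 'k::field) \<Rightarrow> ('b \<times> 'b \<Rightarrow>\<^sub>0 'k)) \<Rightarrow> (('b \<Rightarrow>\<^sub>0 'k) \<Rightarrow> 'k) \<Rightarrow>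
      (('b \<times> 'b \<Rightarrow>\<^sub>0 'k) \<Rightarrow> ('b \<Rightarrow>\<^sub>0 'k)) \<Rightarrow> ('b \<Rightarrow>\<^sub>0 'k) \<Rightarrow> ('b \<Rightarrow>\<^sub>0 'k) \<Rightarrow> ('b \<Rightarrow>\<^sub>0 'k)"
  where "right_act \<Delta> \<epsilon> p x y =
    sweedler (inv_into UNIV (left_reg_map \<Delta> p) (x \<otimes>\<^sub>k y)) (\<lambda>u v. \<epsilon> v *\<^sub>k u)"

definition left_act ::
    "(('b \<Rightarrow>\<^sub>0 'k::field) \<Rightarrow> ('b \<times> 'b \<Rightarrow>\<^sub>0 'k)) \<Rightarrow> (('b \<Rightarrow>\<^sub>0 'k) \<Rightarrow> 'k) \<Rightarrow>
      (('b \<times> 'b \<Rightarrow>\<^sub>0 'k) \<Rightarrow> ('b \<Rightarrow>\<^sub>0 'k)) \<Rightarrow> (('b \<times> 'b \<Rightarrow>\<^sub>0 'k) \<Rightarrow> ('b \<Rightarrow>\<^sub>0 'k)) \<Rightarrow>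
      ('b \<Rightarrow>\<^sub>0 'k) \<Rightarrow> ('b \<Rightarrow>\<^sub>0 'k) \<Rightarrow> ('b \<Rightarrow>\<^sub>0 'k)"
  where "left_act \<Delta> \<epsilon> p d x y =
    sweedler (\<Delta> y) (\<lambda>y1 y2. d (y2 \<otimes>\<^sub>k right_act \<Delta> \<epsilon> p x y1))"

definition weak_braiding ::
    "(('b \<Rightarrow>\<^sub>0 'k::field) \<Rightarrow> ('b \<times> 'b \<Rightarrow>\<^sub>0 'k)) \<Rightarrow> (('b \<Rightarrow>\<^sub>0 'k) \<Rightarrow> 'k) \<Rightarrow>
      (('b \<times> 'b \<Rightarrow>\<^sub>0 'k) \<Rightarrow> ('b \<Rightarrow>\<^sub>0 'k)) \<Rightarrow> (('b \<times> 'b \<Rightarrow>\<^sub>0 'k) \<Rightarrow> ('b \<Rightarrow>\<^sub>0 'k)) \<Rightarrow>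
      ('b \<times> 'b \<Rightarrow>\<^sub>0 'k) \<Rightarrow> ('b \<times> 'b \<Rightarrow>\<^sub>0 'k)"
  where "weak_braiding \<Delta> \<epsilon> p d t = sweedler t (\<lambda>h l.
    sweedler (\<Delta> h) (\<lambda>h1 h2. sweedler (\<Delta> l) (\<lambda>l1 l2.
      left_act \<Delta> \<epsilon> p d h1 l1 \<otimes>\<^sub>k right_act \<Delta> \<epsilon> p h2 l2)))"


section \<open>Rank one pointed Hopf algebras\<close>

definition character :: "('g, 'm) monoid_scheme \<Rightarrow> ('g \<Rightarrow> 'k::field) \<Rightarrow> bool"
  where "character G \<chi> \<longleftrightarrow> (\<forall>g\<in>carrier G. \<chi> g \<noteq> 0) \<and>
    (\<forall>g\<in>carrier G. \<forall>h\<in>carrier G. \<chi> (g \<otimes>\<^bsub>G\<^esub> h) = \<chi> g * \<chi> h)"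

definition mult_order :: "'k::field \<Rightarrow> nat"
  where "mult_order c = (LEAST m. 0 < m \<and> c ^ m = 1)"

text \<open>The group algebra of \<open>G\<close> is the space of finitely supported functions on \<open>G\<close>.\<close>

locale rank_one_datum = group G
  for G :: "'g monoid"
    and \<chi> :: "'g \<Rightarrow> 'k::field"
    and a :: 'g
    and \<alpha> :: 'k +
  assumes finite_G: "finite (carrier G)"
    and char_\<chi>: "character G \<chi>"
    and a_closed: "a \<in> carrier G"
    and a_central: "\<And>g. g \<in> carrier G \<Longrightarrow> a \<otimes>\<^bsub>G\<^esub> g = g \<otimes>\<^bsub>G\<^esub> a"
    and order_gt_1: "mult_order (\<chi> a) > 1"
    and datum_condition:
      "\<alpha> *\<^sub>k (bvec (a [^]\<^bsub>G\<^esub> mult_order (\<chi> a)) - bvec \<one>\<^bsub>G\<^esub>) = 0 \<or>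
       (\<forall>g\<in>carrier G. \<chi> g ^ mult_order (\<chi> a) = 1)"

text \<open>
  The free algebra on \<open>G \<union> {x}\<close> is the monoid algebra of the words in these letters; the product
  of \<open>'a \<Rightarrow>\<^sub>0 'k\<close> provided by the library is convolution with respect to the addition of \<open>'a\<close>,
  which is therefore concatenation here.
\<close>

datatype 'g letter = Grp 'g | Var

datatype 'a word = Word (letters: "'a list")

instantiation word :: (type) monoid_add
begin

definition zero_word :: "'a word" where "zero_word = Word []"

definition plus_word :: "'a word \<Rightarrow> 'a word \<Rightarrow> 'a word"
  where "plus_word u v = Word (letters u @ letters v)"

instance by standard (auto simp: zero_word_def plus_word_def)

end

definition free_algebra :: "'g monoid \<Rightarrow> ('g letter word \<Rightarrow>\<^sub>0 'k::field) ring"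
  where "free_algebra G = \<lparr>
    carrier = {f. \<forall>w\<in>Poly_Mapping.keys f. set (letters w) \<subseteq> insert Var (Grp ` carrier G)},
    monoid.mult = (*), one = 1, zero = 0, add = (+)\<rparr>"

lemma ring_free_algebra: "ring (free_algebra G :: ('g letter word \<Rightarrow>\<^sub>0 'k::field) ring)"
proof -
  let ?F = "free_algebra G :: ('g letter word \<Rightarrow>\<^sub>0 'k) ring"
  have mem: "f \<in> carrier ?F \<longleftrightarrow>
      Poly_Mapping.keys f \<subseteq> {w. set (letters w) \<subseteq> insert Var (Grp ` carrier G)}" for f
    by (auto simp: free_algebra_def)
  have ops: "f \<oplus>\<^bsub>?F\<^esub> g = f + g" "f \<otimes>\<^bsub>?F\<^esub> g = f * g" "\<one>\<^bsub>?F\<^esub> = 1" "\<zero>\<^bsub>?F\<^esub> = 0" for f g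
    by (simp_all add: free_algebra_def)
  have mult_closed: "f * g \<in> carrier ?F" if "f \<in> carrier ?F" "g \<in> carrier ?F" for f g
    using that keys_mult[of f g] by (fastforce simp: mem plus_word_def)
  have add_closed: "f + g \<in> carrier ?F" if "f \<in> carrier ?F" "g \<in> carrier ?F" for f g
    using that Poly_Mapping.keys_add[of f g] by (auto simp: mem)
  have neg_closed: "- f \<in> carrier ?F" if "f \<in> carrier ?F" for f
    using that by (auto simp: mem in_keys_iff)
  have one_closed: "1 \<in> carrier ?F" and zero_closed: "0 \<in> carrier ?F"
    by (simp_all add: mem zero_word_def)
  have "abelian_group ?F"
  proof (rule abelian_groupI)
    fix f assume "f \<in> carrier ?F"
    then show "\<exists>g\<in>carrier ?F. g \<oplus>\<^bsub>?F\<^esub> f = \<zero>\<^bsub>?F\<^esub>"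
      by (intro bexI[of _ "- f"] neg_closed) (simp_all add: ops)
  qed (simp_all add: ops add_closed zero_closed add.assoc add.commute)
  moreover have "Group.monoid ?F"
    by (rule monoidI) (simp_all add: ops mult_closed one_closed mult.assoc)
  ultimately show ?thesis
    by (rule ringI) (simp_all add: ops algebra_simps)
qed

definition rank_one_relations ::
    "'g monoid \<Rightarrow> ('g \<Rightarrow> 'k) \<Rightarrow> 'g \<Rightarrow> 'k \<Rightarrow> ('g letter word \<Rightarrow>\<^sub>0 'k::field) set"
  where "rank_one_relations G \<chi> a \<alpha> =
    {bvec (Word [Grp g, Grp h]) - bvec (Word [Grp (g \<otimes>\<^bsub>G\<^esub> h)]) |g h.
       g \<in> carrier G \<and> h \<in> carrier G} \<union>
    {bvec (Word [Grp \<one>\<^bsub>G\<^esub>]) - 1} \<union>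
    {bvec (Word (replicate (mult_order (\<chi> a)) Var)) -
       \<alpha> *\<^sub>k (bvec (Word [Grp (a [^]\<^bsub>G\<^esub> mult_order (\<chi> a))]) - 1)} \<union>
    {bvec (Word [Var, Grp g]) - \<chi> g *\<^sub>k bvec (Word [Grp g, Var]) |g. g \<in> carrier G}"

lemma (in rank_one_datum) relations_closed:
  "rank_one_relations G \<chi> a \<alpha> \<subseteq> carrier (free_algebra G)"
proof -
  have k: "Poly_Mapping.keys (f - g) \<subseteq> Poly_Mapping.keys f \<union> Poly_Mapping.keys g" for f g :: "'z \<Rightarrow>\<^sub>0 'k"
    by (auto simp: in_keys_iff lookup_minus)
  have s: "Poly_Mapping.keys (c *\<^sub>k f) \<subseteq> Poly_Mapping.keys f" for c and f :: "'z \<Rightarrow>\<^sub>0 'k"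
    by (auto simp: in_keys_iff lookup_smul)
  have *: "f \<in> carrier (free_algebra G) \<longleftrightarrow> Poly_Mapping.keys f \<subseteq> {w. set (letters w) \<subseteq> insert Var (Grp ` carrier G)}"
    for f :: "_ \<Rightarrow>\<^sub>0 'k" by (auto simp: free_algebra_def)
  have d: "f - g \<in> carrier (free_algebra G)" if "f \<in> carrier (free_algebra G)" "g \<in> carrier (free_algebra G)"
    for f g :: "_ \<Rightarrow>\<^sub>0 'k" using that k[of f g] by (auto simp: *)
  have e: "c *\<^sub>k f \<in> carrier (free_algebra G)" if "f \<in> carrier (free_algebra G)" for c and f :: "_ \<Rightarrow>\<^sub>0 'k"
    using that s[of c f] by (auto simp: *)
  have o: "(1 :: _ \<Rightarrow>\<^sub>0 'k) \<in> carrier (free_algebra G)"  by (simp add: free_algebra_def zero_word_def)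
  have w: "bvec (Word l) \<in> carrier (free_algebra G :: (_ \<Rightarrow>\<^sub>0 'k) ring)" if "set l \<subseteq> insert Var (Grp ` carrier G)" for l
    using that by (simp add: free_algebra_def bvec_def)
  show ?thesis unfolding rank_one_relations_def
    by (auto intro!: d e o w simp: a_closed)
qed

fun eval_letter :: "('g \<Rightarrow> 'h) \<Rightarrow> 'h \<Rightarrow> 'g letter \<Rightarrow> 'h"
  where "eval_letter \<iota> x (Grp g) = \<iota> g"
  | "eval_letter \<iota> x Var = x"

definition eval_free ::
    "(('b \<Rightarrow>\<^sub>0 'k::field) \<Rightarrow> ('b \<Rightarrow>\<^sub>0 'k) \<Rightarrow> ('b \<Rightarrow>\<^sub>0 'k)) \<Rightarrow> ('b \<Rightarrow>\<^sub>0 'k) \<Rightarrow>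
      ('g \<Rightarrow> ('b \<Rightarrow>\<^sub>0 'k)) \<Rightarrow> ('b \<Rightarrow>\<^sub>0 'k) \<Rightarrow> ('g letter word \<Rightarrow>\<^sub>0 'k) \<Rightarrow> ('b \<Rightarrow>\<^sub>0 'k)"
  where "eval_free mul oneH \<iota> x f = (\<Sum>w\<in>Poly_Mapping.keys f.
    Poly_Mapping.lookup f w *\<^sub>k foldr (\<lambda>l r. mul (eval_letter \<iota> x l) r) (letters w) oneH)"

text \<open>
  A Hopf algebra is (a copy of) the one attached to the datum if, as an algebra, it is
  presented by the images \<open>\<iota> g\<close> of the group elements and by \<open>x\<close>, subject to the relations above:
  the evaluation homomorphism from the free algebra is onto and its kernel is the two-sided ideal
  generated by the relations.
\<close>

locale rank_one_hopf_algebra =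
  rank_one_datum G \<chi> a \<alpha> + H: hopf_algebra mul oneH \<Delta> \<epsilon>
  for G :: "'g monoid"
    and \<chi> :: "'g \<Rightarrow> 'k::field"
    and a :: 'g
    and \<alpha> :: 'k
    and mul :: "('b \<Rightarrow>\<^sub>0 'k) \<Rightarrow> ('b \<Rightarrow>\<^sub>0 'k) \<Rightarrow> ('b \<Rightarrow>\<^sub>0 'k)"
    and oneH :: "'b \<Rightarrow>\<^sub>0 'k"
    and \<Delta> :: "('b \<Rightarrow>\<^sub>0 'k) \<Rightarrow> ('b \<times> 'b \<Rightarrow>\<^sub>0 'k)"
    and \<epsilon> :: "('b \<Rightarrow>\<^sub>0 'k) \<Rightarrow> 'k" +
  fixes \<iota> :: "'g \<Rightarrow> ('b \<Rightarrow>\<^sub>0 'k)"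
    and x :: "'b \<Rightarrow>\<^sub>0 'k"
  assumes generated: "eval_free mul oneH \<iota> x ` carrier (free_algebra G) = UNIV"
    and presented: "{f \<in> carrier (free_algebra G). eval_free mul oneH \<iota> x f = 0} =
      genideal (free_algebra G) (rank_one_relations G \<chi> a \<alpha>)"
    and comult_x: "\<Delta> x = x \<otimes>\<^sub>k \<iota> a + oneH \<otimes>\<^sub>k x"
    and counit_x: "\<epsilon> x = 0"
    and comult_grp: "g \<in> carrier G \<Longrightarrow> \<Delta> (\<iota> g) = \<iota> g \<otimes>\<^sub>k \<iota> g"
    and counit_grp: "g \<in> carrier G \<Longrightarrow> \<epsilon> (\<iota> g) = 1"

end

theory Submission
  imports Defs
begin

text \<open>
  Two observations make the braiding computable. First, $\overline{G}(v \otimes gx^m) = v \cdot g \otimes gx^m$: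
  in the coproduct of $gx^m$ every term but $g \otimes gx^m$ has a left factor in $Hx$, and
  $v \cdot wx = (v \cdot x) \cdot w = 0$, once it is known that $H \cdot x = 0$ (\<open>p_x_right\<close>). Hence
  $v^g = v \cdot g^{-1}$ and $v^{gx^m} = 0$ for $m > 0$ (\<open>right_act_gx\<close>), and therefore
  ${}^v(gx^m) = gx^m \mathbin{:} v^g$ (\<open>left_act_gx\<close>). Since $H \mathbin{:} x = 0$ as well,
  ${}^{hx^i}(gx^m) = 0$ for $i > 0$, and of the double sum defining $s(hx^j \otimes gx^{j'})$ only the term
  ${}^h(gx^{j'}) \otimes (hx^j)^{ga^{j'}}$ survives (\<open>weak_braiding_gx\<close>). Second, the operations by
  group elements satisfy $hx^j \cdot g = \lambda(g)^j (h \cdot g) x^j$ and its analogue for $:$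
  (\<open>gx_p_iota\<close>), which turns that term into the explicit formula.

  What has to be proved about the brace is thus: $h \cdot a = h$, $h \cdot x = 0$ and $a \cdot g = a$ for
  group elements, with the same for $:$, and that the $h \cdot g$ are images of group elements.
  The first two come from one equation. The $q$-magma map being a coalgebra morphism yields the
  symmetry
  \[ y_{(1)} \mathbin{:} x_{(2)} \otimes x_{(1)} \cdot y_{(2)} = y_{(2)} \mathbin{:} x_{(1)} \otimes x_{(2)} \cdot y_{(1)} \]
  (\<open>q_magma_flip\<close>), which for the pair $h, x$ reads
  $\xi(h)\, x \otimes (h \cdot a - h) = (a - 1) \otimes h \cdot x$. As $\chi(a) \neq 1$, the element $x$ does not
  commute with $a$, so that $x$ and $a - 1$ are linearly independent as soon as $x \neq 0$, and both sides
  vanish (\<open>iota_p_a_iota_p_x\<close>). In the degenerate case $x = 0$ both sides of the formula for $s$ are $0$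
  unless $j = j' = 0$.

  That $h \cdot g$ is the image of a group element follows from it being group-like: an operator
  lowering the filtration by powers of $x$ shows that there are no further group-like elements
  (\<open>grouplike_in_iota\<close>).

  Everything except left regularity is symmetric in the two operations, so each property is proved
  for one of them and transferred by \<open>swap_operations\<close>.
\<close>


section \<open>Linear maps and the Sweedler notation\<close>

interpretation kspace: vector_space "smul :: 'k::field \<Rightarrow> ('b \<Rightarrow>\<^sub>0 'k) \<Rightarrow> ('b \<Rightarrow>\<^sub>0 'k)"
  by (rule vector_space_smul)

lemma vector_space_field: "vector_space ((*) :: 'k::field \<Rightarrow> 'k \<Rightarrow> 'k)"
  by unfold_locales (simp_all add: algebra_simps)

lemma klinear_iff:
  "klinear f \<longleftrightarrow> (\<forall>u v. f (u + v) = f u + f v) \<and> (\<forall>c u. f (c *\<^sub>k u) = c *\<^sub>k f u)"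
  by (simp add: Vector_Spaces.linear_iff vector_space_smul)

lemma kfunctional_iff:
  "kfunctional f \<longleftrightarrow> (\<forall>u v. f (u + v) = f u + f v) \<and> (\<forall>c u. f (c *\<^sub>k u) = c * f u)"
  by (simp add: Vector_Spaces.linear_iff vector_space_smul vector_space_field)

lemma klinear_add: "klinear f \<Longrightarrow> f (u + v) = f u + f v"
  and klinear_scale: "klinear f \<Longrightarrow> f (c *\<^sub>k u) = c *\<^sub>k f u"
  by (simp_all add: klinear_iff)

lemma klinear_zero: "klinear f \<Longrightarrow> f 0 = 0"
  using klinear_scale[of f 0 0] by simp

lemma klinear_sum: "klinear f \<Longrightarrow> f (\<Sum>i\<in>I. u i) = (\<Sum>i\<in>I. f (u i))"
  by (induction I rule: infinite_finite_induct) (auto simp: klinear_zero klinear_add)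

lemma klinear_diff: "klinear f \<Longrightarrow> f (u - v) = f u - f v"
  using klinear_add[of f "u - v" v] by simp

lemma klinear_id: "klinear (\<lambda>u. u)"
  by (simp add: klinear_iff)

lemma klinear_comp: "klinear f \<Longrightarrow> klinear g \<Longrightarrow> klinear (\<lambda>u. f (g u))"
  by (simp add: klinear_iff)

lemma klinear_smul: "klinear f \<Longrightarrow> klinear (\<lambda>u. c *\<^sub>k f u)"
  by (simp add: klinear_iff kspace.scale_right_distrib mult.commute)

lemma klinear_plus: "klinear f \<Longrightarrow> klinear g \<Longrightarrow> klinear (\<lambda>u. f u + g u)"
  by (simp add: klinear_iff kspace.scale_right_distrib)

lemma klinear_functional: "kfunctional f \<Longrightarrow> klinear g \<Longrightarrow> klinear (\<lambda>u. f (g u) *\<^sub>k v)"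
  by (simp add: klinear_iff kfunctional_iff kspace.scale_left_distrib)

lemma klinear_tensor_left: "klinear f \<Longrightarrow> klinear (\<lambda>u. f u \<otimes>\<^sub>k v)"
  by (auto simp: klinear_iff tensor_lookup lookup_add lookup_smul algebra_simps
      intro!: poly_mapping_eqI)

lemma klinear_tensor_right: "klinear f \<Longrightarrow> klinear (\<lambda>u. v \<otimes>\<^sub>k f u)"
  by (auto simp: klinear_iff tensor_lookup lookup_add lookup_smul algebra_simps
      intro!: poly_mapping_eqI)

lemma tensor_scale: "(c *\<^sub>k u) \<otimes>\<^sub>k v = c *\<^sub>k (u \<otimes>\<^sub>k v)" "u \<otimes>\<^sub>k (c *\<^sub>k v) = c *\<^sub>k (u \<otimes>\<^sub>k v)"
  by (rule poly_mapping_eqI; auto simp: tensor_lookup lookup_smul)+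

lemma kfunctional_extend:
  fixes B :: "('b \<Rightarrow>\<^sub>0 'k::field) set"
  assumes "kspace.independent B"
  obtains f where "kfunctional f" "\<And>v. v \<in> B \<Longrightarrow> f v = \<phi> v"
proof -
  interpret vp: vector_space_pair "smul :: 'k \<Rightarrow> ('b \<Rightarrow>\<^sub>0 'k) \<Rightarrow> _" "(*) :: 'k \<Rightarrow> _"
    using vector_space_smul vector_space_field by (simp add: vector_space_pair_def)
  show thesis
    using vp.linear_independent_extend[OF assms, of \<phi>] that by blast
qed

lemma sweedler_superset:
  assumes "finite K" "Poly_Mapping.keys t \<subseteq> K"
  shows "sweedler t B = (\<Sum>(i, j)\<in>K. Poly_Mapping.lookup t (i, j) *\<^sub>k B (bvec i) (bvec j))"
  unfolding sweedler_def using assms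
  by (intro sum.mono_neutral_left) (auto simp: in_keys_iff)

lemma klinear_sweedler: "klinear (\<lambda>t. sweedler t B)"
proof -
  have "sweedler (s + t) B = sweedler s B + sweedler t B" for s t
  proof -
    let ?K = "Poly_Mapping.keys s \<union> Poly_Mapping.keys t"
    have "sweedler v B = (\<Sum>(i, j)\<in>?K. Poly_Mapping.lookup v (i, j) *\<^sub>k B (bvec i) (bvec j))"
      if "v \<in> {s, t, s + t}" for v
      using that Poly_Mapping.keys_add[of s t] by (intro sweedler_superset) auto
    then show ?thesis
      by (simp add: lookup_add kspace.scale_left_distrib sum.distrib case_prod_unfold)
  qed
  moreover have "sweedler (c *\<^sub>k t) B = c *\<^sub>k sweedler t B" for c t
  proof -
    let ?K = "Poly_Mapping.keys t"
    have "sweedler v B = (\<Sum>(i, j)\<in>?K. Poly_Mapping.lookup v (i, j) *\<^sub>k B (bvec i) (bvec j))"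
      if "v \<in> {t, c *\<^sub>k t}" for v
      using that by (intro sweedler_superset) (auto simp: in_keys_iff lookup_smul)
    then show ?thesis
      by (simp add: lookup_smul kspace.scale_sum_right case_prod_unfold)
  qed
  ultimately show ?thesis by (simp add: klinear_iff)
qed

lemma klinear_sweedler_of: "klinear f \<Longrightarrow> klinear (\<lambda>u. sweedler (f u) B)"
  by (rule klinear_comp[OF klinear_sweedler])

lemma klinear_sweedler_param:
  assumes "\<And>v w. klinear (\<lambda>u. B u v w)"
  shows "klinear (\<lambda>u. sweedler t (B u))"
  using assms
  by (simp add: klinear_iff sweedler_def case_prod_unfold kspace.scale_right_distrib
      sum.distrib kspace.scale_sum_right mult.commute)

lemmas klinear_intros = klinear_id klinear_smul klinear_plus klinear_tensor_left klinear_tensor_right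
  klinear_sweedler_of klinear_sweedler_param

lemma sweedler_klinear:
  "klinear f \<Longrightarrow> f (sweedler t B) = sweedler t (\<lambda>u v. f (B u v))"
  by (simp add: sweedler_def klinear_sum klinear_scale case_prod_unfold)

lemma sweedler_sweedler:
  "sweedler (sweedler t B) C = sweedler t (\<lambda>u v. sweedler (B u v) C)"
  by (rule sweedler_klinear[OF klinear_sweedler])

lemma sweedler_tensor_id: "sweedler t (\<lambda>u v. u \<otimes>\<^sub>k v) = t"
proof -
  have "bvec i \<otimes>\<^sub>k bvec j = (bvec (i, j) :: _ \<Rightarrow>\<^sub>0 'c)" for i :: 'a and j :: 'b
    by (rule poly_mapping_eqI) (auto simp: tensor_lookup bvec_def lookup_single when_def
        split: if_splits)
  then show ?thesis
    using bvec_expansion[of t] by (simp add: sweedler_def case_prod_unfold)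
qed

lemma sweedler_sum_tensor:
  assumes "\<And>v. klinear (\<lambda>u. B u v)" "\<And>u. klinear (\<lambda>v. B u v)"
  shows "sweedler (\<Sum>i\<in>I. c i *\<^sub>k (u i \<otimes>\<^sub>k v i)) B = (\<Sum>i\<in>I. c i *\<^sub>k B (u i) (v i))"
  by (simp add: klinear_sum[OF klinear_sweedler] klinear_scale[OF klinear_sweedler]
      sweedler_tensor[OF assms])

lemma sweedler_commute:
  "sweedler s (\<lambda>u1 u2. sweedler t (\<lambda>v1 v2. B u1 u2 v1 v2)) =
   sweedler t (\<lambda>v1 v2. sweedler s (\<lambda>u1 u2. B u1 u2 v1 v2))"
  by (simp add: sweedler_def case_prod_unfold kspace.scale_sum_right mult.commute
      sum.swap[of _ "Poly_Mapping.keys t"])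

text \<open>
  \<open>sweedler\<close> takes values in spaces only; multiplying a basis vector of a one-dimensional space
  by the scalar makes it applicable to the counit of the tensor product.
\<close>

lemma tensor_counit_tensor:
  fixes \<epsilon> :: "('b \<Rightarrow>\<^sub>0 'k::field) \<Rightarrow> 'k" and \<epsilon>' :: "('c \<Rightarrow>\<^sub>0 'k) \<Rightarrow> 'k"
  assumes "kfunctional \<epsilon>" "kfunctional \<epsilon>'"
  shows "tensor_counit \<epsilon> \<epsilon>' (u \<otimes>\<^sub>k v) = \<epsilon> u * \<epsilon>' v"
proof -
  have "tensor_counit \<epsilon> \<epsilon>' t *\<^sub>k (bvec () :: unit \<Rightarrow>\<^sub>0 'k) = sweedler t (\<lambda>u v. (\<epsilon> u * \<epsilon>' v) *\<^sub>k bvec ())"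
    for t
    by (simp add: tensor_counit_def sweedler_def kspace.scale_sum_left case_prod_unfold)
  then have "tensor_counit \<epsilon> \<epsilon>' (u \<otimes>\<^sub>k v) *\<^sub>k (bvec () :: unit \<Rightarrow>\<^sub>0 'k)
      = sweedler (u \<otimes>\<^sub>k v) (\<lambda>u v. (\<epsilon> u * \<epsilon>' v) *\<^sub>k bvec ())" .
  also have "\<dots> = (\<epsilon> u * \<epsilon>' v) *\<^sub>k bvec ()"
    using assms by (intro sweedler_tensor)
      (auto simp: klinear_iff kfunctional_iff algebra_simps kspace.scale_left_distrib)
  finally show ?thesis
    using lookup_single_eq[of "()" "1 :: 'k"] by (auto simp: bvec_def simp del: lookup_single_eq)
qed

text \<open>
  Otherwise a nonzero coordinate of \<open>b\<close> would express \<open>u\<close> as a multiple of \<open>v\<close>.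
\<close>

lemma tensor_eq_imp_zero:
  assumes "u \<otimes>\<^sub>k b = v \<otimes>\<^sub>k c" and "\<And>s. u \<noteq> s *\<^sub>k v" and "v \<noteq> 0"
  shows "b = 0 \<and> c = 0"
proof -
  have eq: "Poly_Mapping.lookup u i * Poly_Mapping.lookup b j
      = Poly_Mapping.lookup v i * Poly_Mapping.lookup c j" for i j
    using assms(1) by (metis tensor_lookup)
  have "b = 0"
  proof (rule ccontr)
    assume "b \<noteq> 0"
    then obtain j where "Poly_Mapping.lookup b j \<noteq> 0"
      using poly_mapping_eqI[of b 0] by auto
    then have "u = (Poly_Mapping.lookup c j / Poly_Mapping.lookup b j) *\<^sub>k v"
      using eq[of _ j] by (intro poly_mapping_eqI) (simp add: lookup_smul field_simps)
    with assms(2) show False by blast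
  qed
  moreover obtain i where "Poly_Mapping.lookup v i \<noteq> 0"
    using assms(3) poly_mapping_eqI[of v 0] by auto
  ultimately have "Poly_Mapping.lookup c j = 0" for j
    using eq[of i j] by simp
  then have "c = 0" by (intro poly_mapping_eqI) simp
  with \<open>b = 0\<close> show ?thesis by simp
qed

lemma tensor_left_cancel:
  assumes "u \<otimes>\<^sub>k b = u \<otimes>\<^sub>k c" and "u \<noteq> 0"
  shows "b = c"
proof -
  obtain i where "Poly_Mapping.lookup u i \<noteq> 0"
    using assms(2) poly_mapping_eqI[of u 0] by auto
  then show ?thesis
    using assms(1) by (intro poly_mapping_eqI) (metis tensor_lookup mult_cancel_left)
qed

lemma tensor_zero [simp]: "0 \<otimes>\<^sub>k v = 0" "u \<otimes>\<^sub>k 0 = 0"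
  by (auto intro: klinear_zero[OF klinear_tensor_left[OF klinear_id]]
      klinear_zero[OF klinear_tensor_right[OF klinear_id]])


section \<open>Consequences of the q-magma map being a coalgebra morphism\<close>

context k_coalgebra
begin

lemmas comult_intros = klinear_intros klinear_comp[OF comult_linear] klinear_functional[OF counit_linear]

lemma klinear_cop: "klinear (cop_comult \<Delta>)"
  unfolding cop_comult_def by (intro comult_intros)

lemma sweedler_cop:
  assumes "\<And>v. klinear (\<lambda>u. B u v)" "\<And>u. klinear (\<lambda>v. B u v)"
  shows "sweedler (cop_comult \<Delta> h) B = sweedler (\<Delta> h) (\<lambda>h1 h2. B h2 h1)"
  unfolding cop_comult_def sweedler_sweedler using assms by (simp add: sweedler_tensor)

end

context q_magma_coalgebra
begin

lemmas q_intros = comult_intros klinear_comp[OF klinear_cop] klinear_comp[OF p_linear] klinear_comp[OF d_linear]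

lemma counit_p_tensor: "\<epsilon> (p (u \<otimes>\<^sub>k v)) = \<epsilon> u * \<epsilon> v"
  and counit_d_tensor: "\<epsilon> (d (u \<otimes>\<^sub>k v)) = \<epsilon> u * \<epsilon> v"
  by (simp_all add: counit_p counit_d tensor_counit_tensor counit_linear)

abbreviation (input) slice_left where "slice_left t \<equiv> sweedler t (\<lambda>u v. \<epsilon> u *\<^sub>k v)"
abbreviation (input) slice_right where "slice_right t \<equiv> sweedler t (\<lambda>u v. \<epsilon> v *\<^sub>k u)"

lemma slice_tensor: "slice_left (u \<otimes>\<^sub>k v) = \<epsilon> u *\<^sub>k v" "slice_right (u \<otimes>\<^sub>k v) = \<epsilon> v *\<^sub>k u"
  by (intro sweedler_tensor comult_intros)+

lemma q_magma_map_tensor: "q_magma_map \<Delta> p d (u \<otimes>\<^sub>k v) =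
    sweedler (\<Delta> u) (\<lambda>u1 u2. sweedler (\<Delta> v) (\<lambda>v1 v2. d (v1 \<otimes>\<^sub>k u2) \<otimes>\<^sub>k p (u1 \<otimes>\<^sub>k v2)))"
  unfolding q_magma_map_def by (rule sweedler_tensor; intro q_intros)

lemma slice_left_q_magma_map: "slice_left (q_magma_map \<Delta> p d (u \<otimes>\<^sub>k v)) = p (u \<otimes>\<^sub>k v)"
proof -
  have inner: "sweedler (\<Delta> v) (\<lambda>v1 v2. (\<epsilon> v1 * \<epsilon> u2) *\<^sub>k p (u1 \<otimes>\<^sub>k v2)) = \<epsilon> u2 *\<^sub>k p (u1 \<otimes>\<^sub>k v)" for u1 u2
    using sweedler_klinear[of "\<lambda>w. \<epsilon> u2 *\<^sub>k p (u1 \<otimes>\<^sub>k w)" "\<Delta> v" "\<lambda>v1 v2. \<epsilon> v1 *\<^sub>k v2"]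
    by (simp add: counit_left q_intros klinear_scale[OF p_linear] klinear_scale[OF klinear_tensor_right[OF klinear_id]] mult.commute)
  have "slice_left (q_magma_map \<Delta> p d (u \<otimes>\<^sub>k v)) = sweedler (\<Delta> u) (\<lambda>u1 u2. \<epsilon> u2 *\<^sub>k p (u1 \<otimes>\<^sub>k v))"
    by (simp add: q_magma_map_tensor sweedler_sweedler slice_tensor counit_d_tensor inner)
  also have "\<dots> = p (u \<otimes>\<^sub>k v)"
    using sweedler_klinear[of "\<lambda>w. p (w \<otimes>\<^sub>k v)" "\<Delta> u" "\<lambda>u1 u2. \<epsilon> u2 *\<^sub>k u1"]
    by (simp add: counit_right q_intros klinear_scale[OF p_linear] klinear_scale[OF klinear_tensor_left[OF klinear_id]])
  finally show ?thesis .
qed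

lemma slice_right_q_magma_map: "slice_right (q_magma_map \<Delta> p d (u \<otimes>\<^sub>k v)) = d (v \<otimes>\<^sub>k u)"
proof -
  have inner: "sweedler (\<Delta> v) (\<lambda>v1 v2. (\<epsilon> u1 * \<epsilon> v2) *\<^sub>k d (v1 \<otimes>\<^sub>k u2)) = \<epsilon> u1 *\<^sub>k d (v \<otimes>\<^sub>k u2)" for u1 u2
    using sweedler_klinear[of "\<lambda>w. \<epsilon> u1 *\<^sub>k d (w \<otimes>\<^sub>k u2)" "\<Delta> v" "\<lambda>v1 v2. \<epsilon> v2 *\<^sub>k v1"]
    by (simp add: counit_right q_intros klinear_scale[OF d_linear] klinear_scale[OF klinear_tensor_left[OF klinear_id]])
  have "slice_right (q_magma_map \<Delta> p d (u \<otimes>\<^sub>k v)) = sweedler (\<Delta> u) (\<lambda>u1 u2. \<epsilon> u1 *\<^sub>k d (v \<otimes>\<^sub>k u2))"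
    by (simp add: q_magma_map_tensor sweedler_sweedler slice_tensor counit_p_tensor inner)
  also have "\<dots> = d (v \<otimes>\<^sub>k u)"
    using sweedler_klinear[of "\<lambda>w. d (v \<otimes>\<^sub>k w)" "\<Delta> u" "\<lambda>u1 u2. \<epsilon> u1 *\<^sub>k u2"]
    by (simp add: counit_left q_intros klinear_scale[OF d_linear] klinear_scale[OF klinear_tensor_right[OF klinear_id]])
  finally show ?thesis .
qed

text \<open>
  A bilinear map applied to the two tensor factors of the identity $\Delta \circ F = (F \otimes F) \circ \Delta$, with the
  co-opposite coproducts resolved, for the $q$-magma map $F$. Taking \<open>B\<close> to be a product of the slices $\epsilon \otimes \mathrm{id}$ and
  $\mathrm{id} \otimes \epsilon$ extracts the statements about the two components of $F$.
\<close>

lemma q_magma_coproduct: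
  defines "F \<equiv> q_magma_map \<Delta> p d"
  assumes "\<And>t. klinear (\<lambda>s. B s t)" "\<And>s. klinear (\<lambda>t. B s t)"
  shows "sweedler (F (u \<otimes>\<^sub>k v)) (\<lambda>r s. sweedler (\<Delta> r) (\<lambda>r1 r2. sweedler (\<Delta> s) (\<lambda>s1 s2.
            B (r2 \<otimes>\<^sub>k s1) (r1 \<otimes>\<^sub>k s2)))) =
         sweedler (\<Delta> u) (\<lambda>u1 u2. sweedler (\<Delta> v) (\<lambda>v1 v2.
            B (F (u1 \<otimes>\<^sub>k v2)) (F (u2 \<otimes>\<^sub>k v1))))"
proof -
  have lin: "klinear F"
    and mor: "tensor_comult (cop_comult \<Delta>) \<Delta> (F t) =
      sweedler (tensor_comult \<Delta> (cop_comult \<Delta>) t) (\<lambda>s s'. F s \<otimes>\<^sub>k F s')" for t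
    using q_magma_morphism by (auto simp: coalgebra_morphism_def F_def)
  note B = sweedler_tensor[of B, OF assms(2,3)]
  have *: "sweedler (tensor_comult (cop_comult \<Delta>) \<Delta> t) B = sweedler t (\<lambda>r s.
      sweedler (\<Delta> r) (\<lambda>r1 r2. sweedler (\<Delta> s) (\<lambda>s1 s2. B (r2 \<otimes>\<^sub>k s1) (r1 \<otimes>\<^sub>k s2))))" for t
    unfolding tensor_comult_def sweedler_sweedler B
    by (subst sweedler_cop) (intro q_intros klinear_comp[OF assms(2)] klinear_comp[OF assms(3)] refl)+
  have "tensor_comult \<Delta> (cop_comult \<Delta>) (u \<otimes>\<^sub>k v) = sweedler (\<Delta> u) (\<lambda>u1 u2.
      sweedler (cop_comult \<Delta> v) (\<lambda>v1 v2. (u1 \<otimes>\<^sub>k v1) \<otimes>\<^sub>k (u2 \<otimes>\<^sub>k v2)))"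
    unfolding tensor_comult_def by (rule sweedler_tensor; intro q_intros)
  also have "\<dots> = sweedler (\<Delta> u) (\<lambda>u1 u2. sweedler (\<Delta> v) (\<lambda>v1 v2. (u1 \<otimes>\<^sub>k v2) \<otimes>\<^sub>k (u2 \<otimes>\<^sub>k v1)))"
    by (subst sweedler_cop) (intro q_intros refl)+
  finally have **: "tensor_comult \<Delta> (cop_comult \<Delta>) (u \<otimes>\<^sub>k v) = \<dots>" .
  have BF: "sweedler (s \<otimes>\<^sub>k s') (\<lambda>s s'. B (F s) (F s')) = B (F s) (F s')" for s s'
    by (rule sweedler_tensor; intro klinear_comp[OF assms(2)] klinear_comp[OF assms(3)] lin)
  show ?thesis
    unfolding *[symmetric] mor
    unfolding ** sweedler_sweedler B BF ..
qed

lemma slice_klinear: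
  assumes "klinear f"
  shows "sweedler (\<Delta> u) (\<lambda>u1 u2. \<epsilon> u1 *\<^sub>k f u2) = f u"
    and "sweedler (\<Delta> u) (\<lambda>u1 u2. \<epsilon> u2 *\<^sub>k f u1) = f u"
  using sweedler_klinear[OF assms, of "\<Delta> u" "\<lambda>u1 u2. \<epsilon> u1 *\<^sub>k u2"]
    sweedler_klinear[OF assms, of "\<Delta> u" "\<lambda>u1 u2. \<epsilon> u2 *\<^sub>k u1"]
  by (simp_all add: counit_left counit_right klinear_scale[OF assms])

lemma slice_counit:
  "sweedler (\<Delta> u) (\<lambda>u1 u2. (\<epsilon> u1 * \<epsilon> u2) *\<^sub>k w) = \<epsilon> u *\<^sub>k w"
  using slice_klinear(1)[of "\<lambda>u. \<epsilon> u *\<^sub>k w"]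
  by (simp add: klinear_functional[OF counit_linear klinear_id])

text \<open>
  With $F$ the $q$-magma map, slicing $F \otimes F$ by $(\mathrm{id} \otimes \epsilon) \otimes (\epsilon \otimes \mathrm{id})$: on the left the counits cancel the
  coproducts and leave $F$, on the right they pick out one operation from each factor.
\<close>

lemma q_magma_flip:
  "sweedler (\<Delta> u) (\<lambda>u1 u2. sweedler (\<Delta> v) (\<lambda>v1 v2. d (v1 \<otimes>\<^sub>k u2) \<otimes>\<^sub>k p (u1 \<otimes>\<^sub>k v2))) =
   sweedler (\<Delta> u) (\<lambda>u1 u2. sweedler (\<Delta> v) (\<lambda>v1 v2. d (v2 \<otimes>\<^sub>k u1) \<otimes>\<^sub>k p (u2 \<otimes>\<^sub>k v1)))"
proof -
  have "sweedler (\<Delta> u) (\<lambda>u1 u2. sweedler (\<Delta> v) (\<lambda>v1 v2. d (v2 \<otimes>\<^sub>k u1) \<otimes>\<^sub>k p (u2 \<otimes>\<^sub>k v1))) =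
    sweedler (q_magma_map \<Delta> p d (u \<otimes>\<^sub>k v)) (\<lambda>r s. sweedler (\<Delta> r) (\<lambda>r1 r2. sweedler (\<Delta> s) (\<lambda>s1 s2.
      (\<epsilon> s1 *\<^sub>k r2) \<otimes>\<^sub>k (\<epsilon> r1 *\<^sub>k s2))))"
    using q_magma_coproduct[of "\<lambda>s t. slice_right s \<otimes>\<^sub>k slice_left t" u v]
    by (simp add: q_intros slice_left_q_magma_map slice_right_q_magma_map slice_tensor)
  also have "\<dots> = sweedler (q_magma_map \<Delta> p d (u \<otimes>\<^sub>k v)) (\<lambda>r s. sweedler (\<Delta> r) (\<lambda>r1 r2.
      r2 \<otimes>\<^sub>k (\<epsilon> r1 *\<^sub>k s)))"
    by (simp add: q_intros tensor_scale(1) slice_klinear(1)[of "\<lambda>w. a \<otimes>\<^sub>k (c *\<^sub>k w)" for a c])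
  also have "\<dots> = q_magma_map \<Delta> p d (u \<otimes>\<^sub>k v)"
    by (simp add: q_intros tensor_scale sweedler_tensor_id slice_klinear(1)[of "\<lambda>w. w \<otimes>\<^sub>k a" for a])
  finally show ?thesis by (simp add: q_magma_map_tensor)
qed

text \<open>
  Slicing by $\epsilon \otimes \mathrm{id}$ in both factors; for \<open>comult_d\<close> below by $\mathrm{id} \otimes \epsilon$ in both.
\<close>

lemma comult_p: "\<Delta> (p (u \<otimes>\<^sub>k v)) =
   sweedler (\<Delta> u) (\<lambda>u1 u2. sweedler (\<Delta> v) (\<lambda>v1 v2. p (u1 \<otimes>\<^sub>k v2) \<otimes>\<^sub>k p (u2 \<otimes>\<^sub>k v1)))"
proof -
  have "sweedler (\<Delta> u) (\<lambda>u1 u2. sweedler (\<Delta> v) (\<lambda>v1 v2. p (u1 \<otimes>\<^sub>k v2) \<otimes>\<^sub>k p (u2 \<otimes>\<^sub>k v1))) =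
    sweedler (q_magma_map \<Delta> p d (u \<otimes>\<^sub>k v)) (\<lambda>r s. sweedler (\<Delta> r) (\<lambda>r1 r2. sweedler (\<Delta> s) (\<lambda>s1 s2.
      (\<epsilon> r2 *\<^sub>k s1) \<otimes>\<^sub>k (\<epsilon> r1 *\<^sub>k s2))))"
    using q_magma_coproduct[of "\<lambda>s t. slice_left s \<otimes>\<^sub>k slice_left t" u v]
    by (simp add: q_intros slice_left_q_magma_map slice_right_q_magma_map slice_tensor)
  also have "\<dots> = sweedler (q_magma_map \<Delta> p d (u \<otimes>\<^sub>k v)) (\<lambda>r s. sweedler (\<Delta> r) (\<lambda>r1 r2.
      \<epsilon> r1 *\<^sub>k (\<epsilon> r2 *\<^sub>k \<Delta> s)))"
    by (simp add: tensor_scale sweedler_tensor_id mult.commute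
        flip: sweedler_klinear[OF klinear_smul[OF klinear_id]] kspace.scale_scale)
  also have "\<dots> = sweedler (q_magma_map \<Delta> p d (u \<otimes>\<^sub>k v)) (\<lambda>r s. \<Delta> (\<epsilon> r *\<^sub>k s))"
    by (simp add: slice_counit klinear_scale[OF comult_linear])
  also have "\<dots> = \<Delta> (slice_left (q_magma_map \<Delta> p d (u \<otimes>\<^sub>k v)))"
    by (rule sweedler_klinear[OF comult_linear, symmetric])
  finally show ?thesis by (simp add: slice_left_q_magma_map)
qed

lemma comult_d: "\<Delta> (d (u \<otimes>\<^sub>k v)) =
   sweedler (\<Delta> u) (\<lambda>u1 u2. sweedler (\<Delta> v) (\<lambda>v1 v2. d (u1 \<otimes>\<^sub>k v2) \<otimes>\<^sub>k d (u2 \<otimes>\<^sub>k v1)))"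
proof -
  have "sweedler (\<Delta> v) (\<lambda>v1 v2. sweedler (\<Delta> u) (\<lambda>u1 u2. d (u1 \<otimes>\<^sub>k v2) \<otimes>\<^sub>k d (u2 \<otimes>\<^sub>k v1))) =
    sweedler (q_magma_map \<Delta> p d (v \<otimes>\<^sub>k u)) (\<lambda>r s. sweedler (\<Delta> r) (\<lambda>r1 r2. sweedler (\<Delta> s) (\<lambda>s1 s2.
      (\<epsilon> s2 *\<^sub>k r1) \<otimes>\<^sub>k (\<epsilon> s1 *\<^sub>k r2))))"
    using q_magma_coproduct[of "\<lambda>s t. slice_right t \<otimes>\<^sub>k slice_right s" v u]
    by (simp add: q_intros slice_left_q_magma_map slice_right_q_magma_map slice_tensor)
  also have "\<dots> = sweedler (q_magma_map \<Delta> p d (v \<otimes>\<^sub>k u)) (\<lambda>r s. sweedler (\<Delta> r) (\<lambda>r1 r2.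
      \<epsilon> s *\<^sub>k (r1 \<otimes>\<^sub>k r2)))"
    by (simp add: slice_counit tensor_scale)
  also have "\<dots> = sweedler (q_magma_map \<Delta> p d (v \<otimes>\<^sub>k u)) (\<lambda>r s. \<Delta> (\<epsilon> s *\<^sub>k r))"
    by (simp add: klinear_scale[OF comult_linear] sweedler_tensor_id
        flip: sweedler_klinear[OF klinear_smul[OF klinear_id]])
  also have "\<dots> = \<Delta> (slice_right (q_magma_map \<Delta> p d (v \<otimes>\<^sub>k u)))"
    by (rule sweedler_klinear[OF comult_linear, symmetric])
  finally have "\<Delta> (d (u \<otimes>\<^sub>k v)) = sweedler (\<Delta> v) (\<lambda>v1 v2. sweedler (\<Delta> u) (\<lambda>u1 u2. d (u1 \<otimes>\<^sub>k v2) \<otimes>\<^sub>k d (u2 \<otimes>\<^sub>k v1)))"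
    by (simp add: slice_right_q_magma_map)
  then show ?thesis by (simp only: sweedler_commute[of "\<Delta> u"])
qed

lemma q_magma_flip':
  "sweedler (\<Delta> u) (\<lambda>u1 u2. sweedler (\<Delta> v) (\<lambda>v1 v2. p (v1 \<otimes>\<^sub>k u2) \<otimes>\<^sub>k d (u1 \<otimes>\<^sub>k v2))) =
   sweedler (\<Delta> u) (\<lambda>u1 u2. sweedler (\<Delta> v) (\<lambda>v1 v2. p (v2 \<otimes>\<^sub>k u1) \<otimes>\<^sub>k d (u2 \<otimes>\<^sub>k v1)))"
proof -
  have swap: "sweedler (r \<otimes>\<^sub>k s) (\<lambda>r s. s \<otimes>\<^sub>k r) = s \<otimes>\<^sub>k r" for r s :: "'b \<Rightarrow>\<^sub>0 'k"
    by (rule sweedler_tensor; intro klinear_intros)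
  show ?thesis
    using arg_cong[OF q_magma_flip[of v u], of "\<lambda>t. sweedler t (\<lambda>r s. s \<otimes>\<^sub>k r)"]
    by (simp only: sweedler_sweedler swap sweedler_commute[of "\<Delta> u"])
qed

end



section \<open>Group-like elements\<close>

text \<open>The antipode inverts group-like elements, so that an idempotent one can be cancelled.\<close>

lemma (in hopf_algebra) grouplike_idempotent:
  assumes "\<Delta> z = z \<otimes>\<^sub>k z" "\<epsilon> z = 1" "mul z z = z"
  shows "z = oneH"
proof -
  obtain S where S: "klinear S" "\<And>h. sweedler (\<Delta> h) (\<lambda>h1 h2. mul (S h1) h2) = \<epsilon> h *\<^sub>k oneH"
    using antipode by blast
  have "sweedler (z \<otimes>\<^sub>k z) (\<lambda>h1 h2. mul (S h1) h2) = mul (S z) z"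
    by (rule sweedler_tensor) (intro mul_linear_right klinear_comp[OF mul_linear_left] S)+
  then have inv: "mul (S z) z = oneH"
    using S(2)[of z] by (simp add: assms)
  then have "mul (S z) (mul z z) = z"
    by (simp add: mul_assoc[symmetric] one_mul)
  with inv show ?thesis by (simp add: assms)
qed

text \<open>
  Linear independence of group-like elements, in the form that is used. Write $z = \sum_v c_v v$ over an
  independent subset of \<open>A\<close> and let $f$ be dual to some $w$ with $c_w \neq 0$. Applying $f \otimes \mathrm{id}$ to
  $z \otimes z = \Delta(z) = \sum_v c_v\, v \otimes v$ gives $c_w z = c_w w$.
\<close>

lemma (in k_coalgebra) grouplike_in_span:
  assumes A: "\<And>v. v \<in> A \<Longrightarrow> \<Delta> v = v \<otimes>\<^sub>k v"
    and z: "\<Delta> z = z \<otimes>\<^sub>k z" "z \<noteq> 0" "z \<in> kspace.span A"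
  shows "z \<in> A"
proof -
  obtain B where B: "B \<subseteq> A" "kspace.independent B" "A \<subseteq> kspace.span B"
    using kspace.maximal_independent_subset[of A] by blast
  have "z \<in> kspace.span B"
    using z(3) B(3) by (meson kspace.span_minimal kspace.subspace_span subsetD)
  then obtain F c where F: "finite F" "F \<subseteq> B" and zF: "z = (\<Sum>v\<in>F. c v *\<^sub>k v)"
    by (auto simp: kspace.span_explicit)
  obtain w where w: "w \<in> F" "c w \<noteq> 0"
    using z(2) unfolding zF by (metis (no_types, lifting) kspace.scale_zero_left sum.neutral)
  obtain f where f: "kfunctional f" "\<And>v. v \<in> B \<Longrightarrow> f v = (if v = w then 1 else 0)"
    using kfunctional_extend[OF B(2), of "\<lambda>v. if v = w then 1 else 0"] by blast
  let ?B = "\<lambda>u v. f u *\<^sub>k v"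
  have lin: "klinear (\<lambda>u. f u *\<^sub>k v)" "klinear (\<lambda>v. f u *\<^sub>k v)" for u v
    by (intro klinear_functional f klinear_id klinear_smul)+
  have fz: "f z = c w"
  proof -
    have "f z *\<^sub>k z = (\<Sum>v\<in>F. (c v * f v) *\<^sub>k z)"
      using klinear_sum[OF lin(1)[of z], of "\<lambda>v. c v *\<^sub>k v" F] f(1) by (simp add: zF[symmetric] kfunctional_iff)
    also have "\<dots> = (\<Sum>v\<in>F. if v = w then c w *\<^sub>k z else 0)"
      using F f(2) by (intro sum.cong) auto
    also have "\<dots> = c w *\<^sub>k z"
      using F(1) w(1) by simp
    finally show ?thesis using z(2) by simp
  qed
  have "\<Delta> z = (\<Sum>v\<in>F. c v *\<^sub>k (v \<otimes>\<^sub>k v))"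
    using A B(1) F(2)
    by (subst zF) (auto simp: klinear_sum[OF comult_linear] klinear_scale[OF comult_linear] intro!: sum.cong)
  then have "sweedler (\<Delta> z) ?B = (\<Sum>v\<in>F. c v *\<^sub>k (f v *\<^sub>k v))"
    by (simp add: sweedler_sum_tensor lin)
  also have "\<dots> = (\<Sum>v\<in>F. if v = w then c w *\<^sub>k w else 0)"
    using F f(2) by (intro sum.cong) auto
  also have "\<dots> = c w *\<^sub>k w"
    using F(1) w(1) by simp
  finally have "f z *\<^sub>k z = c w *\<^sub>k w"
    by (simp add: z(1) sweedler_tensor lin)
  then have "z = w" using w(2) by (simp add: fz)
  with w F B show ?thesis by blast
qed


section \<open>The Hopf algebra of a datum\<close>

text \<open>
  The recursion is the effect on $\Delta(x^m)$ of multiplication by $x \otimes a + 1 \otimes x$ on the right, the power of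
  $q = \chi(a)$ arising from moving $a$ to the left of $x^{m-i}$. Of the coefficients only those for
  \<open>i = 0\<close> and \<open>i = m\<close> enter the braiding; both are \<open>1\<close>.
\<close>

fun gauss_binomial :: "'k::field \<Rightarrow> nat \<Rightarrow> nat \<Rightarrow> 'k"
  where "gauss_binomial q m 0 = 1"
  | "gauss_binomial q 0 (Suc i) = 0"
  | "gauss_binomial q (Suc m) (Suc i) = q ^ (m - i) * gauss_binomial q m i + gauss_binomial q m (Suc i)"

lemma gauss_binomial_eq_0: "m < i \<Longrightarrow> gauss_binomial q m i = 0"
  by (induction q m i rule: gauss_binomial.induct) auto

lemma gauss_binomial_self: "gauss_binomial q m m = 1"
  by (induction m) (auto simp: gauss_binomial_eq_0)

lemma klinear_eval_free: "klinear (eval_free mul oneH \<iota> x)"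
proof -
  define E where "E w = foldr (\<lambda>l r. mul (eval_letter \<iota> x l) r) (letters w) oneH" for w
  have ev: "eval_free mul oneH \<iota> x f = (\<Sum>w\<in>K. Poly_Mapping.lookup f w *\<^sub>k E w)"
    if "finite K" "Poly_Mapping.keys f \<subseteq> K" for K f
    unfolding eval_free_def E_def using that
    by (intro sum.mono_neutral_left) (auto simp: in_keys_iff)
  have "eval_free mul oneH \<iota> x (f + g) = eval_free mul oneH \<iota> x f + eval_free mul oneH \<iota> x g" for f g
    using Poly_Mapping.keys_add[of f g]
    by (simp add: ev[of "Poly_Mapping.keys f \<union> Poly_Mapping.keys g"] lookup_add
        kspace.scale_left_distrib sum.distrib)
  moreover have "eval_free mul oneH \<iota> x (c *\<^sub>k f) = c *\<^sub>k eval_free mul oneH \<iota> x f" for c f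
    by (subst (1 2) ev[of "Poly_Mapping.keys f"])
      (auto simp: in_keys_iff lookup_smul kspace.scale_sum_right)
  ultimately show ?thesis by (simp add: klinear_iff)
qed

context rank_one_hopf_algebra
begin

abbreviation xpow :: "nat \<Rightarrow> ('b \<Rightarrow>\<^sub>0 'k)" where "xpow \<equiv> alg_pow mul oneH x"
abbreviation gx :: "'g \<Rightarrow> nat \<Rightarrow> ('b \<Rightarrow>\<^sub>0 'k)" where "gx g m \<equiv> mul (\<iota> g) (xpow m)"

lemmas h_intros = H.comult_intros klinear_comp[OF H.mul_linear_left] klinear_comp[OF H.mul_linear_right]

lemma eval_word: "eval_free mul oneH \<iota> x (bvec (Word ls)) = foldr (\<lambda>l r. mul (eval_letter \<iota> x l) r) ls oneH"
  by (simp add: eval_free_def bvec_def)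

lemma one_eq_word: "1 = bvec (Word [])"
  by (simp add: bvec_def one_poly_mapping.abs_eq flip: zero_word_def)

lemma relation_vanishes: "f \<in> rank_one_relations G \<chi> a \<alpha> \<Longrightarrow> eval_free mul oneH \<iota> x f = 0"
  using ring.genideal_self[OF ring_free_algebra relations_closed] presented by blast

lemma iota_mult: "g \<in> carrier G \<Longrightarrow> h \<in> carrier G \<Longrightarrow> mul (\<iota> g) (\<iota> h) = \<iota> (g \<otimes>\<^bsub>G\<^esub> h)"
  using relation_vanishes[of "bvec (Word [Grp g, Grp h]) - bvec (Word [Grp (g \<otimes>\<^bsub>G\<^esub> h)])"]
  by (auto simp: rank_one_relations_def klinear_diff[OF klinear_eval_free] eval_word H.mul_one)

lemma iota_one: "\<iota> \<one>\<^bsub>G\<^esub> = oneH"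
  using relation_vanishes[of "bvec (Word [Grp \<one>\<^bsub>G\<^esub>]) - 1"]
  by (auto simp: rank_one_relations_def klinear_diff[OF klinear_eval_free] eval_word H.mul_one one_eq_word)

lemma x_iota: "g \<in> carrier G \<Longrightarrow> mul x (\<iota> g) = \<chi> g *\<^sub>k mul (\<iota> g) x"
  using relation_vanishes[of "bvec (Word [Var, Grp g]) - \<chi> g *\<^sub>k bvec (Word [Grp g, Var])"]
  by (auto simp: rank_one_relations_def klinear_diff[OF klinear_eval_free]
      klinear_scale[OF klinear_eval_free] eval_word H.mul_one)

lemma xpow_0: "xpow 0 = oneH" and xpow_Suc_left: "xpow (Suc m) = mul x (xpow m)"
  by (simp_all add: alg_pow_def)

lemma xpow_Suc: "xpow (Suc m) = mul (xpow m) x"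
proof (induction m)
  case (Suc m)
  have "xpow (Suc (Suc m)) = mul x (mul (xpow m) x)" by (simp only: xpow_Suc_left[of "Suc m"] Suc)
  also have "\<dots> = mul (xpow (Suc m)) x" by (simp only: H.mul_assoc xpow_Suc_left[of m])
  finally show ?case .
qed (simp add: xpow_0 xpow_Suc_left H.mul_one H.one_mul)

lemma gx_Suc: "gx g (Suc m) = mul (gx g m) x"
  by (simp add: xpow_Suc H.mul_assoc)

lemma gx_0: "gx g 0 = \<iota> g"
  by (simp add: xpow_0 H.mul_one)

lemma mul_scale: "mul (c *\<^sub>k u) v = c *\<^sub>k mul u v" "mul u (c *\<^sub>k v) = c *\<^sub>k mul u v"
  by (rule klinear_scale[OF H.mul_linear_left] klinear_scale[OF H.mul_linear_right])+

lemma xpow_iota: "g \<in> carrier G \<Longrightarrow> mul (xpow m) (\<iota> g) = \<chi> g ^ m *\<^sub>k gx g m"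
proof (induction m)
  case (Suc m)
  have "mul (xpow (Suc m)) (\<iota> g) = mul x (mul (xpow m) (\<iota> g))"
    by (simp add: xpow_Suc_left H.mul_assoc)
  also have "\<dots> = \<chi> g ^ m *\<^sub>k mul (mul x (\<iota> g)) (xpow m)"
    using Suc by (simp add: mul_scale H.mul_assoc)
  finally show ?case
    using Suc.prems by (simp add: x_iota mul_scale xpow_Suc_left H.mul_assoc mult.commute)
qed (simp add: xpow_0 H.mul_one H.one_mul)

lemma sweedler_comult_iota:
  assumes "g \<in> carrier G" "\<And>v. klinear (\<lambda>u. B u v)" "\<And>u. klinear (\<lambda>v. B u v)"
  shows "sweedler (\<Delta> (\<iota> g)) B = B (\<iota> g) (\<iota> g)"
  using assms by (simp add: comult_grp sweedler_tensor)

lemma sweedler_comult_x: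
  assumes "\<And>v. klinear (\<lambda>u. B u v)" "\<And>u. klinear (\<lambda>v. B u v)"
  shows "sweedler (\<Delta> x) B = B x (\<iota> a) + B oneH x"
  using assms by (simp add: comult_x klinear_add[OF klinear_sweedler] sweedler_tensor)

lemma comult_gx:
  assumes g: "g \<in> carrier G"
  shows "\<Delta> (gx g m) = (\<Sum>i\<le>m. gauss_binomial (\<chi> a) m i *\<^sub>k
    (gx g i \<otimes>\<^sub>k gx (g \<otimes>\<^bsub>G\<^esub> a [^]\<^bsub>G\<^esub> i) (m - i)))"
proof (induction m)
  case 0
  show ?case using g by (simp add: gx_0 comult_grp)
next
  case (Suc m)
  let ?q = "\<chi> a" and ?c = "gauss_binomial (\<chi> a) m"
  define T where "T i = gx g i \<otimes>\<^sub>k gx (g \<otimes>\<^bsub>G\<^esub> a [^]\<^bsub>G\<^esub> i) (Suc m - i)" for i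
  have left: "mul (gx g i) x \<otimes>\<^sub>k mul (gx (g \<otimes>\<^bsub>G\<^esub> a [^]\<^bsub>G\<^esub> i) (m - i)) (\<iota> a) = ?q ^ (m - i) *\<^sub>k T (Suc i)" for i
  proof -
    have "mul (gx (g \<otimes>\<^bsub>G\<^esub> a [^]\<^bsub>G\<^esub> i) (m - i)) (\<iota> a) =
        ?q ^ (m - i) *\<^sub>k mul (mul (\<iota> (g \<otimes>\<^bsub>G\<^esub> a [^]\<^bsub>G\<^esub> i)) (\<iota> a)) (xpow (m - i))"
      using a_closed by (simp add: H.mul_assoc xpow_iota mul_scale)
    also have "mul (\<iota> (g \<otimes>\<^bsub>G\<^esub> a [^]\<^bsub>G\<^esub> i)) (\<iota> a) = \<iota> (g \<otimes>\<^bsub>G\<^esub> a [^]\<^bsub>G\<^esub> Suc i)"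
      using g a_closed by (simp add: iota_mult m_assoc)
    finally show ?thesis by (simp only: T_def gx_Suc tensor_scale diff_Suc_Suc)
  qed
  have right: "mul (gx g i) oneH \<otimes>\<^sub>k mul (gx (g \<otimes>\<^bsub>G\<^esub> a [^]\<^bsub>G\<^esub> i) (m - i)) x = T i" if "i \<le> m" for i
    using that by (simp add: T_def H.mul_one Suc_diff_le gx_Suc)
  have "\<Delta> (gx g (Suc m)) = sweedler (\<Delta> (gx g m)) (\<lambda>u v. mul u x \<otimes>\<^sub>k mul v (\<iota> a) + mul u oneH \<otimes>\<^sub>k mul v x)"
    unfolding gx_Suc H.comult_mul by (subst sweedler_comult_x) (intro h_intros refl)+
  also have "\<dots> = sweedler (\<Delta> (gx g m)) (\<lambda>u v. mul u x \<otimes>\<^sub>k mul v (\<iota> a))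
      + sweedler (\<Delta> (gx g m)) (\<lambda>u v. mul u oneH \<otimes>\<^sub>k mul v x)"
    by (simp add: sweedler_def case_prod_unfold kspace.scale_right_distrib sum.distrib)
  also have "\<dots> = (\<Sum>i\<le>m. ?c i *\<^sub>k (?q ^ (m - i) *\<^sub>k T (Suc i))) + (\<Sum>i\<le>m. ?c i *\<^sub>k T i)"
  proof -
    have "sweedler (\<Delta> (gx g m)) (\<lambda>u v. mul u x \<otimes>\<^sub>k mul v (\<iota> a)) =
        (\<Sum>i\<le>m. ?c i *\<^sub>k (mul (gx g i) x \<otimes>\<^sub>k mul (gx (g \<otimes>\<^bsub>G\<^esub> a [^]\<^bsub>G\<^esub> i) (m - i)) (\<iota> a)))"
      unfolding Suc by (rule sweedler_sum_tensor; intro h_intros)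
    moreover have "sweedler (\<Delta> (gx g m)) (\<lambda>u v. mul u oneH \<otimes>\<^sub>k mul v x) =
        (\<Sum>i\<le>m. ?c i *\<^sub>k (mul (gx g i) oneH \<otimes>\<^sub>k mul (gx (g \<otimes>\<^bsub>G\<^esub> a [^]\<^bsub>G\<^esub> i) (m - i)) x))"
      unfolding Suc by (rule sweedler_sum_tensor; intro h_intros)
    ultimately show ?thesis
      by (simp only: left) (simp add: right cong: sum.cong_simp)
  qed
  also have "\<dots> = (\<Sum>i\<le>m. (?q ^ (m - i) * ?c i) *\<^sub>k T (Suc i)) + (\<Sum>i\<le>Suc m. ?c i *\<^sub>k T i)"
    by (simp add: mult.commute gauss_binomial_eq_0)
  also have "\<dots> = (\<Sum>i\<le>Suc m. gauss_binomial ?q (Suc m) i *\<^sub>k T i)"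
    by (simp add: sum.atMost_Suc_shift kspace.scale_left_distrib sum.distrib del: sum.atMost_Suc)
  finally show ?case by (simp add: T_def)
qed

lemma span_gx: "kspace.span {gx g m |g m. g \<in> carrier G} = UNIV"
proof -
  let ?M = "kspace.span {gx g m |g m. g \<in> carrier G}"
  have L: "f w \<in> ?M" if "klinear f" "\<And>g m. g \<in> carrier G \<Longrightarrow> f (gx g m) \<in> ?M" "w \<in> ?M" for f w
    using that(3)
  proof (induction rule: kspace.span_induct_alt)
    case base
    show ?case by (simp add: klinear_zero[OF that(1)] kspace.span_zero)
  next
    case (step c u w)
    then have "f u \<in> ?M" using that(2) by blast
    with step show ?case
      unfolding klinear_add[OF that(1)] klinear_scale[OF that(1)]
      by (intro kspace.span_add kspace.span_scale)
  qed
  have base: "gx g m \<in> ?M" if "g \<in> carrier G" for g m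
    using that by (intro kspace.span_base) blast
  have one: "oneH \<in> ?M"
    using base[OF one_closed, of 0] unfolding iota_one xpow_0 H.one_mul .
  have letter: "mul (eval_letter \<iota> x l) w \<in> ?M"
    if "l \<in> insert Var (Grp ` carrier G)" "w \<in> ?M" for l w
  proof (rule L[OF H.mul_linear_right _ that(2)])
    fix g m assume g: "g \<in> carrier G"
    show "mul (eval_letter \<iota> x l) (gx g m) \<in> ?M"
    proof (cases l)
      case (Grp h)
      then have "h \<in> carrier G" using that(1) by auto
      then have "mul (\<iota> h) (gx g m) = gx (h \<otimes>\<^bsub>G\<^esub> g) m"
        using g by (simp only: iota_mult flip: H.mul_assoc)
      then show ?thesis
        using base[OF m_closed, of h g m] g \<open>h \<in> carrier G\<close> by (simp only: Grp eval_letter.simps)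
    next
      case Var
      have "mul x (gx g m) = mul (mul x (\<iota> g)) (xpow m)"
        by (rule H.mul_assoc[symmetric])
      also have "\<dots> = \<chi> g *\<^sub>k gx g (Suc m)"
        using g by (simp only: x_iota mul_scale xpow_Suc_left H.mul_assoc)
      finally show ?thesis
        by (simp only: Var eval_letter.simps kspace.span_scale[OF base[OF g]])
    qed
  qed
  have word: "foldr (\<lambda>l r. mul (eval_letter \<iota> x l) r) ls oneH \<in> ?M"
    if "set ls \<subseteq> insert Var (Grp ` carrier G)" for ls
    using that
  proof (induction ls)
    case Nil
    show ?case using one by simp
  next
    case (Cons l ls)
    then show ?case using letter[of l] by simp
  qed
  have "eval_free mul oneH \<iota> x f \<in> ?M" if "f \<in> carrier (free_algebra G)" for f
    unfolding eval_free_def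
  proof (rule kspace.span_sum, rule kspace.span_scale, rule word)
    show "set (letters w) \<subseteq> insert Var (Grp ` carrier G)" if "w \<in> Poly_Mapping.keys f" for w
      using that \<open>f \<in> carrier (free_algebra G)\<close> by (simp add: free_algebra_def)
  qed
  then have "eval_free mul oneH \<iota> x ` carrier (free_algebra G) \<subseteq> ?M"
    by (rule image_subsetI)
  then show ?thesis
    by (simp only: generated top_unique)
qed

text \<open>
  If \<open>z\<close> were outside the span of the group elements, a functional \<open>f\<close> could vanish on them and take
  the value \<open>1\<close> at \<open>z\<close>. Then $T = (f \otimes \mathrm{id}) \circ \Delta$ fixes \<open>z\<close>, but it annihilates the group elements and maps
  $gx^m$ to a combination of $g'x^i$ with $i < m$, so that it is locally nilpotent. Inside the span,
  \<open>grouplike_in_span\<close> applies.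
\<close>

lemma grouplike_in_iota:
  assumes z: "\<Delta> z = z \<otimes>\<^sub>k z" "\<epsilon> z = 1"
  shows "\<exists>g\<in>carrier G. z = \<iota> g"
proof -
  have z0: "z \<noteq> 0"
    using z(2) H.counit_linear kfunctional_iff[of \<epsilon>] by (metis mult_zero_left kspace.scale_zero_left zero_neq_one)
  have "z \<in> kspace.span (\<iota> ` carrier G)"
  proof (rule ccontr)
    assume notin: "z \<notin> kspace.span (\<iota> ` carrier G)"
    obtain C where C: "C \<subseteq> \<iota> ` carrier G" "kspace.independent C" "\<iota> ` carrier G \<subseteq> kspace.span C"
      using kspace.maximal_independent_subset by blast
    have zC: "z \<notin> kspace.span C"
      using notin C(1) kspace.span_mono by blast
    obtain f where f: "kfunctional f" "\<And>v. v \<in> insert z C \<Longrightarrow> f v = (if v = z then 1 else 0)"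
      using kfunctional_extend[OF kspace.independent_insertI[OF zC C(2)],
          of "\<lambda>v. if v = z then 1 else 0"] by blast
    have fC: "f v = 0" if "v \<in> kspace.span C" for v
      using that
    proof (induction rule: kspace.span_induct_alt)
      case base
      then show ?case using f(1) kfunctional_iff[of f] by (metis mult_zero_left kspace.scale_zero_left)
    next
      case (step c u w)
      then have "u \<noteq> z" using zC kspace.span_base by blast
      then show ?case using step f by (simp add: kfunctional_iff)
    qed
    define T where "T v = sweedler (\<Delta> v) (\<lambda>v1 v2. f v1 *\<^sub>k v2)" for v
    have bil: "klinear (\<lambda>u. f u *\<^sub>k v)" "klinear (\<lambda>v. f u *\<^sub>k v)" for u v
      by (intro klinear_functional f klinear_id klinear_smul)+
    have "klinear T" unfolding T_def by (intro h_intros)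
    then have T: "klinear (T ^^ k)" for k
      by (induction k) (auto simp: klinear_iff)
    have "T z = z" using f(2)[of z] by (simp add: T_def z(1) sweedler_tensor bil)
    then have Tz: "(T ^^ k) z = z" for k by (induction k) auto
    have Tg: "(T ^^ k) (gx g m) = 0" if "g \<in> carrier G" "m < k" for g m k
      using that
    proof (induction k arbitrary: g m)
      case (Suc k)
      have Tgx: "T (gx g m) = (\<Sum>i\<le>m. gauss_binomial (\<chi> a) m i *\<^sub>k (f (gx g i) *\<^sub>k gx (g \<otimes>\<^bsub>G\<^esub> a [^]\<^bsub>G\<^esub> i) (m - i)))"
        unfolding T_def comult_gx[OF Suc.prems(1)] by (rule sweedler_sum_tensor) (rule bil)+
      have "f (gx g 0) = 0"
        using C(3) Suc.prems(1) by (intro fC) (auto simp: gx_0)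
      moreover have "(T ^^ k) (gx (g \<otimes>\<^bsub>G\<^esub> a [^]\<^bsub>G\<^esub> i) (m - i)) = 0" if "0 < i" "i \<le> m" for i
        using that Suc.prems a_closed by (intro Suc.IH) auto
      ultimately have "gauss_binomial (\<chi> a) m i *\<^sub>k (f (gx g i) *\<^sub>k
          (T ^^ k) (gx (g \<otimes>\<^bsub>G\<^esub> a [^]\<^bsub>G\<^esub> i) (m - i))) = 0" if "i \<le> m" for i
        using that by (cases "i = 0") simp_all
      then have "(T ^^ k) (T (gx g m)) = 0"
        unfolding Tgx klinear_sum[OF T] klinear_scale[OF T] by (intro sum.neutral) auto
      then show ?case by (simp only: funpow_Suc_right o_apply)
    qed simp
    have "\<exists>k0. \<forall>k\<ge>k0. (T ^^ k) w = 0" if "w \<in> kspace.span {gx g m |g m. g \<in> carrier G}" for w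
      using that
    proof (induction rule: kspace.span_induct_alt)
      case (step c u w)
      then obtain g m k0 where "g \<in> carrier G" "u = gx g m" "\<forall>k\<ge>k0. (T ^^ k) w = 0" by blast
      then show ?case using Tg[of g m]
        by (intro exI[of _ "max k0 (Suc m)"]) (auto simp: klinear_add[OF T] klinear_scale[OF T])
    qed (simp add: klinear_zero[OF T])
    then obtain k where "(T ^^ k) z = 0" by (metis span_gx UNIV_I order_refl)
    with Tz z0 show False by simp
  qed
  then show ?thesis
    using H.grouplike_in_span[of "\<iota> ` carrier G" z] comult_grp z(1) z0 by auto
qed

end



section \<open>Hopf q-braces on the Hopf algebra of a datum\<close>

text \<open>
  The assumptions form a list that is invariant under the exchange of \<open>(p, lam)\<close> and \<open>(d, xi)\<close>. For this
  reason the symmetry of the $q$-magma map is assumed in both of its readings, and left regularity,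
  which concerns \<open>p\<close> alone, belongs to \<open>rank_one_q_brace\<close>.
\<close>

locale rank_one_q_pair = rank_one_hopf_algebra G \<chi> a \<alpha> mul oneH \<Delta> \<epsilon> \<iota> x
  for G :: "'g monoid"
    and \<chi> :: "'g \<Rightarrow> 'k::field"
    and a :: 'g
    and \<alpha> :: 'k
    and mul :: "('b \<Rightarrow>\<^sub>0 'k) \<Rightarrow> ('b \<Rightarrow>\<^sub>0 'k) \<Rightarrow> ('b \<Rightarrow>\<^sub>0 'k)"
    and oneH :: "'b \<Rightarrow>\<^sub>0 'k"
    and \<Delta> :: "('b \<Rightarrow>\<^sub>0 'k) \<Rightarrow> ('b \<times> 'b \<Rightarrow>\<^sub>0 'k)"
    and \<epsilon> :: "('b \<Rightarrow>\<^sub>0 'k) \<Rightarrow> 'k"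
    and \<iota> :: "'g \<Rightarrow> ('b \<Rightarrow>\<^sub>0 'k)"
    and x :: "'b \<Rightarrow>\<^sub>0 'k" +
  fixes p d :: "('b \<times> 'b \<Rightarrow>\<^sub>0 'k) \<Rightarrow> ('b \<Rightarrow>\<^sub>0 'k)"
    and lam xi :: "'g \<Rightarrow> 'k"
  assumes p_linear: "klinear p" and d_linear: "klinear d"
    and counit_p: "\<epsilon> (p (u \<otimes>\<^sub>k v)) = \<epsilon> u * \<epsilon> v"
    and counit_d: "\<epsilon> (d (u \<otimes>\<^sub>k v)) = \<epsilon> u * \<epsilon> v"
    and comult_p: "\<Delta> (p (u \<otimes>\<^sub>k v)) =
      sweedler (\<Delta> u) (\<lambda>u1 u2. sweedler (\<Delta> v) (\<lambda>v1 v2. p (u1 \<otimes>\<^sub>k v2) \<otimes>\<^sub>k p (u2 \<otimes>\<^sub>k v1)))"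
    and comult_d: "\<Delta> (d (u \<otimes>\<^sub>k v)) =
      sweedler (\<Delta> u) (\<lambda>u1 u2. sweedler (\<Delta> v) (\<lambda>v1 v2. d (u1 \<otimes>\<^sub>k v2) \<otimes>\<^sub>k d (u2 \<otimes>\<^sub>k v1)))"
    and flip_dp: "sweedler (\<Delta> u) (\<lambda>u1 u2. sweedler (\<Delta> v) (\<lambda>v1 v2. d (v1 \<otimes>\<^sub>k u2) \<otimes>\<^sub>k p (u1 \<otimes>\<^sub>k v2))) =
      sweedler (\<Delta> u) (\<lambda>u1 u2. sweedler (\<Delta> v) (\<lambda>v1 v2. d (v2 \<otimes>\<^sub>k u1) \<otimes>\<^sub>k p (u2 \<otimes>\<^sub>k v1)))"
    and flip_pd: "sweedler (\<Delta> u) (\<lambda>u1 u2. sweedler (\<Delta> v) (\<lambda>v1 v2. p (v1 \<otimes>\<^sub>k u2) \<otimes>\<^sub>k d (u1 \<otimes>\<^sub>k v2))) =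
      sweedler (\<Delta> u) (\<lambda>u1 u2. sweedler (\<Delta> v) (\<lambda>v1 v2. p (v2 \<otimes>\<^sub>k u1) \<otimes>\<^sub>k d (u2 \<otimes>\<^sub>k v1)))"
    and p_one: "p (u \<otimes>\<^sub>k oneH) = u" and d_one: "d (u \<otimes>\<^sub>k oneH) = u"
    and p_mul: "p (u \<otimes>\<^sub>k mul v w) = p (p (u \<otimes>\<^sub>k w) \<otimes>\<^sub>k v)"
    and d_mul: "d (u \<otimes>\<^sub>k mul v w) = d (d (u \<otimes>\<^sub>k w) \<otimes>\<^sub>k v)"
    and mul_p: "p (mul u v \<otimes>\<^sub>k w) = sweedler (\<Delta> v) (\<lambda>v1 v2. sweedler (\<Delta> w) (\<lambda>w1 w2.
          mul (p (u \<otimes>\<^sub>k d (w1 \<otimes>\<^sub>k v2))) (p (v1 \<otimes>\<^sub>k w2))))"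
    and mul_d: "d (mul u v \<otimes>\<^sub>k w) = sweedler (\<Delta> v) (\<lambda>v1 v2. sweedler (\<Delta> w) (\<lambda>w1 w2.
          mul (d (u \<otimes>\<^sub>k p (w1 \<otimes>\<^sub>k v2))) (d (v1 \<otimes>\<^sub>k w2))))"
    and p_xx: "p (x \<otimes>\<^sub>k x) = 0" and d_xx: "d (x \<otimes>\<^sub>k x) = 0"
    and char_lam: "character G lam" and char_xi: "character G xi"
    and p_x: "g \<in> carrier G \<Longrightarrow> p (x \<otimes>\<^sub>k \<iota> g) = lam g *\<^sub>k x"
    and d_x: "g \<in> carrier G \<Longrightarrow> d (x \<otimes>\<^sub>k \<iota> g) = xi g *\<^sub>k x"
begin

lemma swap_operations: "rank_one_q_pair G \<chi> a \<alpha> mul oneH \<Delta> \<epsilon> \<iota> x d p xi lam"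
  by (rule rank_one_q_pair.intro[OF rank_one_hopf_algebra_axioms], rule rank_one_q_pair_axioms.intro,
      rule d_linear, rule p_linear, rule counit_d, rule counit_p, rule comult_d, rule comult_p,
      rule flip_pd, rule flip_dp, rule d_one, rule p_one, rule d_mul, rule p_mul, rule mul_d,
      rule mul_p, rule d_xx, rule p_xx, rule char_xi, rule char_lam, erule d_x, erule p_x)

lemmas pd_intros = h_intros klinear_comp[OF p_linear] klinear_comp[OF d_linear]

lemma p_zero: "p 0 = 0" and d_zero: "d 0 = 0"
  by (rule klinear_zero[OF p_linear] klinear_zero[OF d_linear])+

lemma p_scale: "p ((c *\<^sub>k u) \<otimes>\<^sub>k v) = c *\<^sub>k p (u \<otimes>\<^sub>k v)" "p (u \<otimes>\<^sub>k (c *\<^sub>k v)) = c *\<^sub>k p (u \<otimes>\<^sub>k v)"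
  by (simp_all add: tensor_scale klinear_scale[OF p_linear])

lemma mul_zero: "mul 0 u = 0" "mul u 0 = 0"
  by (rule klinear_zero[OF H.mul_linear_left] klinear_zero[OF H.mul_linear_right])+

lemma p_iota_grouplike:
  assumes "h \<in> carrier G" "g \<in> carrier G"
  shows "\<Delta> (p (\<iota> h \<otimes>\<^sub>k \<iota> g)) = p (\<iota> h \<otimes>\<^sub>k \<iota> g) \<otimes>\<^sub>k p (\<iota> h \<otimes>\<^sub>k \<iota> g)"
    and "\<epsilon> (p (\<iota> h \<otimes>\<^sub>k \<iota> g)) = 1"
  using assms by (simp_all add: comult_p sweedler_comult_iota pd_intros counit_p counit_grp)

lemma p_iota:
  assumes "h \<in> carrier G" "g \<in> carrier G"
  shows "\<exists>u\<in>carrier G. p (\<iota> h \<otimes>\<^sub>k \<iota> g) = \<iota> u"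
  by (rule grouplike_in_iota) (rule p_iota_grouplike[OF assms])+

text \<open>
  From $1 = 1 \cdot 1$ in $H$, the element $1 \cdot g$ is idempotent, and it is group-like.
\<close>

lemma one_p_iota:
  assumes g: "g \<in> carrier G"
  shows "p (oneH \<otimes>\<^sub>k \<iota> g) = oneH"
proof (rule H.grouplike_idempotent)
  have "p (mul oneH oneH \<otimes>\<^sub>k \<iota> g) = mul (p (oneH \<otimes>\<^sub>k d (\<iota> g \<otimes>\<^sub>k oneH))) (p (oneH \<otimes>\<^sub>k \<iota> g))"
    unfolding mul_p
    using g by (simp add: sweedler_comult_iota pd_intros H.comult_one sweedler_tensor)
  then show "mul (p (oneH \<otimes>\<^sub>k \<iota> g)) (p (oneH \<otimes>\<^sub>k \<iota> g)) = p (oneH \<otimes>\<^sub>k \<iota> g)"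
    by (simp add: d_one H.one_mul)
qed (use p_iota_grouplike[OF one_closed g] in \<open>simp_all add: iota_one\<close>)

text \<open>
  Here the formula for a product gives $1 \cdot x = 1 \cdot x + 1 \cdot x$.
\<close>

lemma one_p_x: "p (oneH \<otimes>\<^sub>k x) = 0"
proof -
  interpret sw: rank_one_q_pair G \<chi> a \<alpha> mul oneH \<Delta> \<epsilon> \<iota> x d p xi lam by (rule swap_operations)
  have "p (mul oneH oneH \<otimes>\<^sub>k x) = mul (p (oneH \<otimes>\<^sub>k d (x \<otimes>\<^sub>k oneH))) (p (oneH \<otimes>\<^sub>k \<iota> a))
      + mul (p (oneH \<otimes>\<^sub>k d (oneH \<otimes>\<^sub>k oneH))) (p (oneH \<otimes>\<^sub>k x))"
    unfolding mul_p by (simp add: H.comult_one sweedler_tensor sweedler_comult_x pd_intros)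
  then show ?thesis
    by (simp add: d_one p_one H.one_mul H.mul_one one_p_iota a_closed)
qed

lemma chi_a: "\<chi> a \<noteq> 1"
proof
  assume "\<chi> a = 1"
  then have "mult_order (\<chi> a) = 1"
    unfolding mult_order_def by (intro Least_equality) auto
  with order_gt_1 show False by simp
qed

lemma iota_inv_mul: "g \<in> carrier G \<Longrightarrow> mul (\<iota> (inv\<^bsub>G\<^esub> g)) (mul (\<iota> g) u) = u"
  by (simp add: iota_mult iota_one H.one_mul flip: H.mul_assoc)

text \<open>
  All multiples of $a - 1$ commute with $a$, whereas $xa = \chi(a)\,ax$ with $\chi(a) \neq 1$.
\<close>

lemma x_a_independent:
  assumes "x \<noteq> 0"
  shows "\<iota> a - oneH \<noteq> 0" and "x \<noteq> c *\<^sub>k (\<iota> a - oneH)"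
proof -
  have ax: "mul x (\<iota> a) \<noteq> mul (\<iota> a) x"
  proof
    assume "mul x (\<iota> a) = mul (\<iota> a) x"
    then have "(\<chi> a - 1) *\<^sub>k mul (\<iota> a) x = 0"
      using x_iota[OF a_closed] by (simp add: kspace.scale_left_diff_distrib)
    then have "mul (\<iota> a) x = 0" using chi_a by simp
    then have "x = 0" using iota_inv_mul[OF a_closed, of x] by (simp add: mul_zero)
    with assms show False ..
  qed
  show "\<iota> a - oneH \<noteq> 0"
    using ax by (metis H.one_mul H.mul_one right_minus_eq)
  show "x \<noteq> c *\<^sub>k (\<iota> a - oneH)"
  proof
    assume x: "x = c *\<^sub>k (\<iota> a - oneH)"
    have "mul x (\<iota> a) = mul (\<iota> a) x"
      unfolding x by (simp only: mul_scale klinear_diff[OF H.mul_linear_left]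
          klinear_diff[OF H.mul_linear_right] H.one_mul H.mul_one)
    with ax show False ..
  qed
qed

text \<open>
  Comparing $\Delta(x \cdot g)$ with $\lambda(g)\,\Delta(x)$.
\<close>

lemma a_p_iota:
  assumes "x \<noteq> 0" and g: "g \<in> carrier G"
  shows "p (\<iota> a \<otimes>\<^sub>k \<iota> g) = \<iota> a"
proof -
  have "lam g *\<^sub>k \<Delta> x = (lam g *\<^sub>k x) \<otimes>\<^sub>k p (\<iota> a \<otimes>\<^sub>k \<iota> g) + oneH \<otimes>\<^sub>k (lam g *\<^sub>k x)"
    using comult_p[of x "\<iota> g"] g
    by (simp add: sweedler_comult_x sweedler_comult_iota pd_intros p_x one_p_iota
        klinear_scale[OF H.comult_linear])
  then have "(lam g *\<^sub>k x) \<otimes>\<^sub>k \<iota> a = (lam g *\<^sub>k x) \<otimes>\<^sub>k p (\<iota> a \<otimes>\<^sub>k \<iota> g)"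
    by (simp add: comult_x tensor_scale kspace.scale_right_distrib)
  moreover have "lam g *\<^sub>k x \<noteq> 0"
    using assms char_lam by (simp add: character_def)
  ultimately show ?thesis by (metis tensor_left_cancel)
qed

lemma iota_p_a_iota_p_x:
  assumes "x \<noteq> 0" and h: "h \<in> carrier G"
  shows "p (\<iota> h \<otimes>\<^sub>k \<iota> a) = \<iota> h" and "p (\<iota> h \<otimes>\<^sub>k x) = 0"
proof -
  interpret sw: rank_one_q_pair G \<chi> a \<alpha> mul oneH \<Delta> \<epsilon> \<iota> x d p xi lam by (rule swap_operations)
  let ?y = "p (\<iota> h \<otimes>\<^sub>k \<iota> a)" and ?z = "p (\<iota> h \<otimes>\<^sub>k x)"
  have "(xi h *\<^sub>k x) \<otimes>\<^sub>k ?y + oneH \<otimes>\<^sub>k ?z = \<iota> a \<otimes>\<^sub>k ?z + (xi h *\<^sub>k x) \<otimes>\<^sub>k \<iota> h"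
    using flip_dp[of "\<iota> h" x] h assms(1)
    by (simp add: sweedler_comult_x sweedler_comult_iota pd_intros d_x sw.one_p_iota sw.a_p_iota p_one)
  then have "x \<otimes>\<^sub>k (xi h *\<^sub>k (?y - \<iota> h)) = (\<iota> a - oneH) \<otimes>\<^sub>k ?z"
    by (simp add: tensor_scale klinear_diff[OF klinear_tensor_left[OF klinear_id]]
        klinear_diff[OF klinear_tensor_right[OF klinear_id]] kspace.scale_right_diff_distrib
        algebra_simps)
  then have "xi h *\<^sub>k (?y - \<iota> h) = 0 \<and> ?z = 0"
    using x_a_independent[OF assms(1)] by (intro tensor_eq_imp_zero) auto
  then show "?y = \<iota> h" "?z = 0"
    using char_xi h by (auto simp: character_def)
qed

lemma iota_p_x: "h \<in> carrier G \<Longrightarrow> p (\<iota> h \<otimes>\<^sub>k x) = 0"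
  using iota_p_a_iota_p_x(2) by (cases "x = 0") (auto simp: p_zero)

lemma gx_p_iota:
  assumes "h \<in> carrier G" and g: "g \<in> carrier G"
  shows "p (gx h j \<otimes>\<^sub>k \<iota> g) = lam g ^ j *\<^sub>k mul (p (\<iota> h \<otimes>\<^sub>k \<iota> g)) (xpow j)"
proof (induction j)
  case 0
  show ?case by (simp add: xpow_0 H.mul_one)
next
  case (Suc j)
  interpret sw: rank_one_q_pair G \<chi> a \<alpha> mul oneH \<Delta> \<epsilon> \<iota> x d p xi lam by (rule swap_operations)
  have "p (gx h (Suc j) \<otimes>\<^sub>k \<iota> g) = mul (p (gx h j \<otimes>\<^sub>k d (\<iota> g \<otimes>\<^sub>k \<iota> a))) (lam g *\<^sub>k x)"
    unfolding gx_Suc mul_p[of "gx h j"] using g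
    by (simp add: sweedler_comult_x sweedler_comult_iota pd_intros p_x sw.iota_p_x p_zero mul_zero)
  also have "\<dots> = mul (p (gx h j \<otimes>\<^sub>k \<iota> g)) (lam g *\<^sub>k x)"
    using sw.iota_p_a_iota_p_x(1)[OF _ g] by (cases "x = 0") (auto simp: mul_zero)
  finally show ?case
    by (simp add: Suc mul_scale xpow_Suc H.mul_assoc mult.commute)
qed

text \<open>
  Each of the four terms of $hx^j x \cdot x$ contains one of the factors $hx^j \cdot x$, $x \cdot x$, $x \mathbin{:} x$
  and $1 \mathbin{:} x$, all of which are zero.
\<close>

lemma gx_p_x: "h \<in> carrier G \<Longrightarrow> p (gx h j \<otimes>\<^sub>k x) = 0"
proof (induction j)
  case 0
  then show ?case by (simp add: gx_0 iota_p_x)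
next
  case (Suc j)
  interpret sw: rank_one_q_pair G \<chi> a \<alpha> mul oneH \<Delta> \<epsilon> \<iota> x d p xi lam by (rule swap_operations)
  show ?case
    unfolding gx_Suc mul_p[of "gx h j"] using Suc
    by (simp add: sweedler_comult_x pd_intros p_xx d_xx d_x a_closed p_scale sw.one_p_x p_zero mul_zero)
qed

lemma p_x_right: "p (v \<otimes>\<^sub>k x) = 0"
proof -
  have "v \<in> kspace.span {gx g m |g m. g \<in> carrier G}" by (simp only: span_gx UNIV_I)
  then show ?thesis
  proof (induction rule: kspace.span_induct_alt)
    case (step c u w)
    have "klinear (\<lambda>v. p (v \<otimes>\<^sub>k x))" by (intro pd_intros)
    then show ?case
      using step gx_p_x by (auto simp: klinear_add klinear_scale klinear_iff)
  qed (simp add: p_zero)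
qed

lemma p_gx_right: "0 < m \<Longrightarrow> p (v \<otimes>\<^sub>k gx g m) = 0"
  by (cases m) (simp_all add: gx_Suc p_mul p_x_right p_zero)

end

section \<open>The weak braiding operator\<close>

lemma klinear_inv:
  assumes "klinear F" "bij F"
  shows "klinear (inv_into UNIV F)"
proof -
  have F: "F (inv_into UNIV F u) = u" for u
    using assms(2) by (simp add: bij_is_surj surj_f_inv_f)
  have inv: "inv_into UNIV F u = v" if "F v = u" for u v
    using that assms(2) by (simp add: bij_is_inj inv_f_eq)
  show ?thesis
    unfolding klinear_iff
    by (intro conjI allI inv) (simp_all add: klinear_add[OF assms(1)] klinear_scale[OF assms(1)] F)
qed

locale rank_one_q_brace = rank_one_q_pair +
  assumes left_regular: "bij (left_reg_map \<Delta> p)"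
begin

lemma klinear_left_reg_map: "klinear (left_reg_map \<Delta> p)"
  unfolding left_reg_map_def by (rule klinear_sweedler)

lemma klinear_right_act:
  "klinear (\<lambda>u. right_act \<Delta> \<epsilon> p u v)" "klinear (\<lambda>v. right_act \<Delta> \<epsilon> p u v)"
  unfolding right_act_def
  by (intro klinear_sweedler_of klinear_comp[OF klinear_inv[OF klinear_left_reg_map left_regular]]
      klinear_intros)+

lemmas act_intros = pd_intros klinear_comp[OF klinear_right_act(1)] klinear_comp[OF klinear_right_act(2)]

lemma klinear_left_act:
  "klinear (\<lambda>u. left_act \<Delta> \<epsilon> p d u v)" "klinear (\<lambda>v. left_act \<Delta> \<epsilon> p d u v)"
  unfolding left_act_def by (intro act_intros)+

lemma left_reg_map_gx:
  assumes g: "g \<in> carrier G"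
  shows "left_reg_map \<Delta> p (v \<otimes>\<^sub>k gx g m) = p (v \<otimes>\<^sub>k \<iota> g) \<otimes>\<^sub>k gx g m"
proof -
  have "left_reg_map \<Delta> p (v \<otimes>\<^sub>k gx g m) = sweedler (\<Delta> (gx g m)) (\<lambda>y1 y2. p (v \<otimes>\<^sub>k y1) \<otimes>\<^sub>k y2)"
    unfolding left_reg_map_def by (rule sweedler_tensor; intro pd_intros)
  also have "\<dots> = (\<Sum>i\<le>m. gauss_binomial (\<chi> a) m i *\<^sub>k
      (p (v \<otimes>\<^sub>k gx g i) \<otimes>\<^sub>k gx (g \<otimes>\<^bsub>G\<^esub> a [^]\<^bsub>G\<^esub> i) (m - i)))"
    unfolding comult_gx[OF g] by (rule sweedler_sum_tensor; intro pd_intros)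
  also have "\<dots> = (\<Sum>i\<le>m. if i = 0 then p (v \<otimes>\<^sub>k \<iota> g) \<otimes>\<^sub>k gx g m else 0)"
    using g by (intro sum.cong) (auto simp: p_gx_right gx_0)
  finally show ?thesis by simp
qed

lemma counit_gx: "g \<in> carrier G \<Longrightarrow> \<epsilon> (gx g m) = (if m = 0 then 1 else 0)"
  by (cases m) (simp_all add: gx_0 gx_Suc H.counit_mul counit_grp counit_x)

text \<open>
  By the previous lemma $v \cdot g^{-1} \otimes gx^m$ is a preimage of $v \otimes gx^m$ under $\overline{G}$; the counit then
  kills $gx^m$ for $m > 0$.
\<close>

lemma right_act_gx:
  assumes g: "g \<in> carrier G"
  shows "right_act \<Delta> \<epsilon> p v (gx g m) = (if m = 0 then p (v \<otimes>\<^sub>k \<iota> (inv\<^bsub>G\<^esub> g)) else 0)"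
proof -
  have "left_reg_map \<Delta> p (p (v \<otimes>\<^sub>k \<iota> (inv\<^bsub>G\<^esub> g)) \<otimes>\<^sub>k gx g m) = v \<otimes>\<^sub>k gx g m"
    using g by (simp add: left_reg_map_gx iota_mult iota_one p_one flip: p_mul)
  then have "inv_into UNIV (left_reg_map \<Delta> p) (v \<otimes>\<^sub>k gx g m) = p (v \<otimes>\<^sub>k \<iota> (inv\<^bsub>G\<^esub> g)) \<otimes>\<^sub>k gx g m"
    using left_regular by (simp add: bij_is_inj inv_f_eq)
  then show ?thesis
    using g by (simp add: right_act_def sweedler_tensor pd_intros counit_gx)
qed

lemmas right_act_iota = right_act_gx[where m = 0, simplified gx_0, simplified]

lemma left_act_gx:
  assumes g: "g \<in> carrier G"
  shows "left_act \<Delta> \<epsilon> p d u (gx g m) = d (gx g m \<otimes>\<^sub>k p (u \<otimes>\<^sub>k \<iota> (inv\<^bsub>G\<^esub> g)))"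
proof -
  have "left_act \<Delta> \<epsilon> p d u (gx g m) = (\<Sum>i\<le>m. gauss_binomial (\<chi> a) m i *\<^sub>k
      d (gx (g \<otimes>\<^bsub>G\<^esub> a [^]\<^bsub>G\<^esub> i) (m - i) \<otimes>\<^sub>k right_act \<Delta> \<epsilon> p u (gx g i)))"
    unfolding left_act_def comult_gx[OF g] by (rule sweedler_sum_tensor; intro act_intros)
  also have "\<dots> = (\<Sum>i\<le>m. if i = 0 then d (gx g m \<otimes>\<^sub>k p (u \<otimes>\<^sub>k \<iota> (inv\<^bsub>G\<^esub> g))) else 0)"
    using g by (intro sum.cong) (auto simp: right_act_gx d_zero)
  finally show ?thesis by simp
qed

lemma left_act_gx_gx:
  assumes h: "h \<in> carrier G" and g: "g \<in> carrier G" and "0 < i"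
  shows "left_act \<Delta> \<epsilon> p d (gx h i) (gx g m) = 0"
proof -
  interpret sw: rank_one_q_pair G \<chi> a \<alpha> mul oneH \<Delta> \<epsilon> \<iota> x d p xi lam by (rule swap_operations)
  obtain u where "u \<in> carrier G" "p (\<iota> h \<otimes>\<^sub>k \<iota> (inv\<^bsub>G\<^esub> g)) = \<iota> u"
    using p_iota[OF h inv_closed[OF g]] by blast
  then show ?thesis
    using assms by (simp add: left_act_gx gx_p_iota sw.p_scale sw.p_gx_right)
qed

text \<open>
  In the coproduct of $gx^j$ the factor ${h_{(2)}}^{l_{(2)}}$ leaves only the last term, with $l_{(2)} = ga^j$;
  in that of $hx^i$ the factor ${}^{h_{(1)}}(gx^j)$ leaves only the first, with $h_{(1)} = h$.
\<close>

lemma weak_braiding_gx: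
  assumes h: "h \<in> carrier G" and g: "g \<in> carrier G"
  shows "weak_braiding \<Delta> \<epsilon> p d (gx h i \<otimes>\<^sub>k gx g j) =
    left_act \<Delta> \<epsilon> p d (\<iota> h) (gx g j) \<otimes>\<^sub>k right_act \<Delta> \<epsilon> p (gx h i) (\<iota> (g \<otimes>\<^bsub>G\<^esub> a [^]\<^bsub>G\<^esub> j))"
proof -
  let ?L = "left_act \<Delta> \<epsilon> p d" and ?R = "right_act \<Delta> \<epsilon> p" and ?c = "gauss_binomial (\<chi> a)"
  note intros = act_intros klinear_comp[OF klinear_left_act(1)] klinear_comp[OF klinear_left_act(2)]
  have inner: "sweedler (\<Delta> (gx g j)) (\<lambda>l1 l2. ?L u1 l1 \<otimes>\<^sub>k ?R u2 l2) =
      ?L u1 (gx g j) \<otimes>\<^sub>k ?R u2 (\<iota> (g \<otimes>\<^bsub>G\<^esub> a [^]\<^bsub>G\<^esub> j))" for u1 u2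
  proof -
    have "sweedler (\<Delta> (gx g j)) (\<lambda>l1 l2. ?L u1 l1 \<otimes>\<^sub>k ?R u2 l2) =
      (\<Sum>k\<le>j. ?c j k *\<^sub>k (?L u1 (gx g k) \<otimes>\<^sub>k ?R u2 (gx (g \<otimes>\<^bsub>G\<^esub> a [^]\<^bsub>G\<^esub> k) (j - k))))"
      unfolding comult_gx[OF g] by (rule sweedler_sum_tensor; intro intros)
    also have "\<dots> = (\<Sum>k\<le>j. if k = j then ?L u1 (gx g j) \<otimes>\<^sub>k ?R u2 (\<iota> (g \<otimes>\<^bsub>G\<^esub> a [^]\<^bsub>G\<^esub> j)) else 0)"
      using g a_closed by (intro sum.cong) (auto simp: right_act_gx right_act_iota gauss_binomial_self)
    finally show ?thesis by simp
  qed
  have "weak_braiding \<Delta> \<epsilon> p d (gx h i \<otimes>\<^sub>k gx g j) = sweedler (\<Delta> (gx h i)) (\<lambda>h1 h2.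
      sweedler (\<Delta> (gx g j)) (\<lambda>l1 l2. ?L h1 l1 \<otimes>\<^sub>k ?R h2 l2))"
    unfolding weak_braiding_def by (rule sweedler_tensor; intro intros)
  also have "\<dots> = (\<Sum>k\<le>i. ?c i k *\<^sub>k (?L (gx h k) (gx g j) \<otimes>\<^sub>k
      ?R (gx (h \<otimes>\<^bsub>G\<^esub> a [^]\<^bsub>G\<^esub> k) (i - k)) (\<iota> (g \<otimes>\<^bsub>G\<^esub> a [^]\<^bsub>G\<^esub> j))))"
    unfolding inner comult_gx[OF h] by (rule sweedler_sum_tensor; intro intros)
  also have "\<dots> = (\<Sum>k\<le>i. if k = 0 then ?L (\<iota> h) (gx g j) \<otimes>\<^sub>k
      ?R (gx h i) (\<iota> (g \<otimes>\<^bsub>G\<^esub> a [^]\<^bsub>G\<^esub> j)) else 0)"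
    using h g by (intro sum.cong) (auto simp: left_act_gx_gx gx_0)
  finally show ?thesis by simp
qed

text \<open>
  $h^{ga^j} = h^g$, because $a$ and hence its inverse act trivially on group elements.
\<close>

lemma p_inv_a_pow:
  fixes j :: nat
  assumes "x \<noteq> 0" and h: "h \<in> carrier G" and g: "g \<in> carrier G"
  shows "p (\<iota> h \<otimes>\<^sub>k \<iota> (inv\<^bsub>G\<^esub> (g \<otimes>\<^bsub>G\<^esub> a [^]\<^bsub>G\<^esub> j))) = p (\<iota> h \<otimes>\<^sub>k \<iota> (inv\<^bsub>G\<^esub> g))"
proof -
  obtain u where u: "u \<in> carrier G" "p (\<iota> h \<otimes>\<^sub>k \<iota> (inv\<^bsub>G\<^esub> g)) = \<iota> u"
    using p_iota[OF h inv_closed[OF g]] by blast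
  have pow: "p (\<iota> u \<otimes>\<^sub>k \<iota> (a [^]\<^bsub>G\<^esub> j)) = \<iota> u"
  proof (induction j)
    case 0
    show ?case by (simp add: iota_one p_one)
  next
    case (Suc j)
    then show ?case
      using iota_p_a_iota_p_x(1)[OF assms(1) u(1)] a_closed by (simp add: p_mul flip: iota_mult)
  qed
  have "p (\<iota> u \<otimes>\<^sub>k \<iota> (inv\<^bsub>G\<^esub> (a [^]\<^bsub>G\<^esub> j))) = p (p (\<iota> u \<otimes>\<^sub>k \<iota> (a [^]\<^bsub>G\<^esub> j)) \<otimes>\<^sub>k \<iota> (inv\<^bsub>G\<^esub> (a [^]\<^bsub>G\<^esub> j)))"
    by (simp only: pow)
  also have "\<dots> = \<iota> u"
    using a_closed by (simp add: iota_mult iota_one p_one flip: p_mul)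
  finally have "p (p (\<iota> h \<otimes>\<^sub>k \<iota> (inv\<^bsub>G\<^esub> g)) \<otimes>\<^sub>k \<iota> (inv\<^bsub>G\<^esub> (a [^]\<^bsub>G\<^esub> j))) = \<iota> u"
    by (simp add: u)
  then show ?thesis
    using g a_closed by (simp add: inv_mult_group u p_mul flip: iota_mult)
qed

lemma lam_inv: "g \<in> carrier G \<Longrightarrow> lam (inv\<^bsub>G\<^esub> g) = inverse (lam g)"
proof -
  assume g: "g \<in> carrier G"
  have "lam \<one>\<^bsub>G\<^esub> * lam \<one>\<^bsub>G\<^esub> = lam \<one>\<^bsub>G\<^esub>" "lam \<one>\<^bsub>G\<^esub> \<noteq> 0"
    using char_lam unfolding character_def by (metis one_closed l_one)+
  then have "lam (inv\<^bsub>G\<^esub> g) * lam g = 1"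
    using g char_lam unfolding character_def by (metis inv_closed l_inv mult_cancel_left2)
  then show ?thesis by (metis inverse_unique mult.commute)
qed

text \<open>
  If $x = 0$ then $h^{ga^j} = h^g$ may fail for $j > 0$, but in that case $gx^j = 0$ and both tensors have
  a vanishing left factor.
\<close>

lemma act_gx_tensor:
  assumes h: "h \<in> carrier G" and g: "g \<in> carrier G"
    and u: "u \<in> carrier G" "\<iota> u = right_act \<Delta> \<epsilon> p (\<iota> h) (\<iota> g)"
  shows "left_act \<Delta> \<epsilon> p d (\<iota> h) (gx g j) \<otimes>\<^sub>k right_act \<Delta> \<epsilon> p (gx h i) (\<iota> (g \<otimes>\<^bsub>G\<^esub> a [^]\<^bsub>G\<^esub> j)) =
    (xi u ^ j *\<^sub>k mul (left_act \<Delta> \<epsilon> p d (\<iota> h) (\<iota> g)) (xpow j)) \<otimes>\<^sub>k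
    (inverse (lam (g \<otimes>\<^bsub>G\<^esub> a [^]\<^bsub>G\<^esub> j)) ^ i *\<^sub>k mul (right_act \<Delta> \<epsilon> p (\<iota> h) (\<iota> g)) (xpow i))"
proof -
  interpret sw: rank_one_q_pair G \<chi> a \<alpha> mul oneH \<Delta> \<epsilon> \<iota> x d p xi lam by (rule swap_operations)
  let ?w = "g \<otimes>\<^bsub>G\<^esub> a [^]\<^bsub>G\<^esub> j"
  have w: "?w \<in> carrier G" using g a_closed by simp
  have pu: "p (\<iota> h \<otimes>\<^sub>k \<iota> (inv\<^bsub>G\<^esub> g)) = \<iota> u"
    using u g by (simp add: right_act_iota)
  have left: "left_act \<Delta> \<epsilon> p d (\<iota> h) (gx g j) = xi u ^ j *\<^sub>k mul (left_act \<Delta> \<epsilon> p d (\<iota> h) (\<iota> g)) (xpow j)" for j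
    using left_act_gx[OF g, of "\<iota> h" 0] left_act_gx[OF g, of "\<iota> h" j] sw.gx_p_iota[OF g u(1)]
    by (simp add: pu gx_0)
  show ?thesis
  proof (cases "x = 0 \<and> 0 < j")
    case True
    then obtain m where "j = Suc m" using gr0_conv_Suc by blast
    then have "gx g j = mul (gx g m) x" by (simp only: gx_Suc)
    then have "gx g j = 0" using True by (simp only: mul_zero)
    then have "left_act \<Delta> \<epsilon> p d (\<iota> h) (gx g j) = 0"
      by (simp add: klinear_zero[OF klinear_left_act(2)])
    then show ?thesis by (simp flip: left)
  next
    case False
    then have "p (\<iota> h \<otimes>\<^sub>k \<iota> (inv\<^bsub>G\<^esub> ?w)) = \<iota> u"
      using p_inv_a_pow[OF _ h g] g pu by (cases "x = 0") simp_all
    then have "right_act \<Delta> \<epsilon> p (gx h i) (\<iota> ?w) = inverse (lam ?w) ^ i *\<^sub>k mul (\<iota> u) (xpow i)"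
      using h w by (simp add: right_act_iota gx_p_iota lam_inv)
    then show ?thesis by (simp add: left flip: u(2))
  qed
qed

end

theorem mainTheorem8:
  fixes G :: "'g monoid"
    and \<chi> lam xi :: "'g \<Rightarrow> 'k::{alg_closed_field, field_char_0}"
    and a h g :: 'g
    and \<alpha> :: 'k
    and mul :: "('b \<Rightarrow>\<^sub>0 'k) \<Rightarrow> ('b \<Rightarrow>\<^sub>0 'k) \<Rightarrow> ('b \<Rightarrow>\<^sub>0 'k)"
    and oneH x :: "'b \<Rightarrow>\<^sub>0 'k"
    and \<Delta> :: "('b \<Rightarrow>\<^sub>0 'k) \<Rightarrow> ('b \<times> 'b \<Rightarrow>\<^sub>0 'k)"
    and \<epsilon> :: "('b \<Rightarrow>\<^sub>0 'k) \<Rightarrow> 'k"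
    and \<iota> :: "'g \<Rightarrow> ('b \<Rightarrow>\<^sub>0 'k)"
    and p d :: "('b \<times> 'b \<Rightarrow>\<^sub>0 'k) \<Rightarrow> ('b \<Rightarrow>\<^sub>0 'k)"
    and n j j' :: nat
  assumes datum: "rank_one_datum G \<chi> a \<alpha>"
    and n: "n = mult_order (\<chi> a)"
    and H: "rank_one_hopf_algebra G \<chi> a \<alpha> mul oneH \<Delta> \<epsilon> \<iota> x"
    and brace: "hopf_q_brace mul oneH \<Delta> \<epsilon> p d"
    and xx: "p (x \<otimes>\<^sub>k x) = 0" "d (x \<otimes>\<^sub>k x) = 0"
    and char_lam: "character G lam" "\<And>u. u \<in> carrier G \<Longrightarrow> p (x \<otimes>\<^sub>k \<iota> u) = lam u *\<^sub>k x"
    and char_xi: "character G xi" "\<And>u. u \<in> carrier G \<Longrightarrow> d (x \<otimes>\<^sub>k \<iota> u) = xi u *\<^sub>k x"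
    and hg: "h \<in> carrier G" "g \<in> carrier G"
    and jj': "j < n" "j' < n"
  shows "\<exists>u\<in>carrier G. \<iota> u = right_act \<Delta> \<epsilon> p (\<iota> h) (\<iota> g) \<and>
      weak_braiding \<Delta> \<epsilon> p d
          (mul (\<iota> h) (alg_pow mul oneH x j) \<otimes>\<^sub>k mul (\<iota> g) (alg_pow mul oneH x j')) =
        left_act \<Delta> \<epsilon> p d (\<iota> h) (mul (\<iota> g) (alg_pow mul oneH x j')) \<otimes>\<^sub>k
        right_act \<Delta> \<epsilon> p (mul (\<iota> h) (alg_pow mul oneH x j)) (\<iota> (g \<otimes>\<^bsub>G\<^esub> a [^]\<^bsub>G\<^esub> j')) \<and>
      left_act \<Delta> \<epsilon> p d (\<iota> h) (mul (\<iota> g) (alg_pow mul oneH x j')) \<otimes>\<^sub>k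
        right_act \<Delta> \<epsilon> p (mul (\<iota> h) (alg_pow mul oneH x j)) (\<iota> (g \<otimes>\<^bsub>G\<^esub> a [^]\<^bsub>G\<^esub> j')) =
        (xi u ^ j' *\<^sub>k mul (left_act \<Delta> \<epsilon> p d (\<iota> h) (\<iota> g)) (alg_pow mul oneH x j')) \<otimes>\<^sub>k
        (inverse (lam (g \<otimes>\<^bsub>G\<^esub> a [^]\<^bsub>G\<^esub> j')) ^ j *\<^sub>k
          mul (right_act \<Delta> \<epsilon> p (\<iota> h) (\<iota> g)) (alg_pow mul oneH x j))"
proof -
  interpret H: rank_one_hopf_algebra G \<chi> a \<alpha> mul oneH \<Delta> \<epsilon> \<iota> x by (rule H)
  interpret B: hopf_q_brace mul oneH \<Delta> \<epsilon> p d by (rule brace)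
  interpret Q: rank_one_q_brace G \<chi> a \<alpha> mul oneH \<Delta> \<epsilon> \<iota> x p d lam xi
    by (rule rank_one_q_brace.intro, rule rank_one_q_pair.intro[OF H], rule rank_one_q_pair_axioms.intro,
        rule B.p_linear, rule B.d_linear, rule B.counit_p_tensor, rule B.counit_d_tensor,
        rule B.comult_p, rule B.comult_d, rule B.q_magma_flip, rule B.q_magma_flip', rule B.p_one,
        rule B.d_one, rule B.p_mul, rule B.d_mul, rule B.mul_p, rule B.mul_d, rule xx, rule xx,
        rule char_lam, rule char_xi, erule char_lam, erule char_xi,
        rule rank_one_q_brace_axioms.intro, rule B.left_regular)
  obtain u where u: "u \<in> carrier G" "\<iota> u = right_act \<Delta> \<epsilon> p (\<iota> h) (\<iota> g)"
    using Q.p_iota[OF hg(1) H.inv_closed[OF hg(2)]] hg by (auto simp: Q.right_act_iota)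
  then show ?thesis
    using Q.weak_braiding_gx[OF hg] Q.act_gx_tensor[OF hg u] by blast
qed

end
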